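(* Let $t$ be a seed of a field $\mathbb K\supseteq\mathbb C$ with vertex set $I$, let $D$ be a finite set disjoint from $I$, let $\mathbb L$ be a $D$-pointed field extension of $\mathbb K$, and let $\nu\in\mathbb Z^{D\times I}$ be a lifting matrix on $t$, with associated monomial lifting ${\uparrow}t$. Then: (1) Lifting commutes with mutation: for every $k\in I_{uf}$, the mutation $\mu_k({\uparrow}t)$ equals the monomial lifting of $\mu_k(t)$ associated with $\mu_k(\nu)$. (2) For every seed $t'$ mutation equivalent to $t$ there is a well-defined lifting matrix $\nu'$ on $t'$ obtained from $\nu$ through the mutation process; that is, if $t'=\mu_{k_r}\circ\dots\circ\mu_{k_1}(t)=\mu_{j_s}\circ\dots\circ\mu_{j_1}(t)$, then $\mu_{k_r}\circ\dots\circ\mu_{k_1}(\nu)=\mu_{j_s}\circ\dots\circ\mu_{j_1}(\nu)$. (3) $\mathcal A({\uparrow}t)=\mathcal A(t)[{\uparrow}x_d^{\pm1}]_{d\in D}$. (4) If $t$ is of maximal rank, then $\overline{\mathcal A}({\uparrow}t)=\overline{\mathcal A}(t)[{\uparrow}x_d^{\pm1}]_{d\in D}$.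
   Context: Cluster conventions. A seed $t$ of a field extension $\mathbb K$ of $\mathbb C$ is a tuple $(I_{uf},I_{sf},I_{hf},B,x)$: disjoint finite sets of unfrozen (mutable), semi-frozen and highly-frozen vertices, $I=I_{uf}\sqcup I_{sf}\sqcup I_{hf}$; an integer matrix $B=(b_{i,j})\in\mathbb Z^{I\times I_{uf}}$ whose restriction to $I_{uf}\times I_{uf}$ is skew-symmetrizable; and $x=(x_i)_{i\in I}\in(\mathbb K^* )^I$ a transcendence basis of $\mathbb K$ over $\mathbb C$. Write $b^+=\max(b,0)$, $b^-=\max(-b,0)$ (entrywise on matrices); $M_{\bullet,k}$ is the $k$-th column of $M$. For $k\in I_{uf}$, the mutation $\mu_k(t)$ has the same vertex sets, matrix $b'_{i,j}=-b_{i,j}$ if $i=k$ or $j=k$, $b'_{i,j}=b_{i,j}+b_{i,k}^+b_{k,j}^+-b_{i,k}^-b_{k,j}^-$ otherwise, and cluster $x'_i=x_i$ for $i\neq k$, $x_k'=x_k^{-1}\bigl(\prod_ix_i^{b_{i,k}^+}+\prod_ix_i^{b_{i,k}^-}\bigr)$. Seeds related by finitely many mutations are equivalent ($\sim$). $\mathcal A(t)$ is the algebra generated over $\mathbb C[x_i]_{i\in I_{hf}}[x_i^{\pm1}]_{i\in I_{sf}}$ by all cluster variables of all seeds equivalent to $t$. $\mathcal L(t)=\mathbb C[x_i]_{i\in I_{hf}}[x_i^{\pm1}]_{i\in I_{sf}\sqcup I_{uf}}$ and $\overline{\mathcal A}(t)=\bigcap_{t'\sim t}\mathcal L(t')$.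 The seed is of maximal rank if $B$ is. Monomial lifting. A $D$-pointed field extension of $\mathbb K$ is a field $\mathbb L=\mathbb K(x_d)_{d\in D}$ with a given tuple $(x_d)_{d\in D}$ algebraically independent over $\mathbb K$. A ($D$-)lifting matrix on $t$ is any $\nu\in\mathbb Z^{D\times I}$; the pair $(\mathbb L,\nu)$ is a lifting configuration. The monomial lifting ${\uparrow}t$ is the seed of $\mathbb L$ with mutable vertices $I_{uf}$, semi-frozen vertices $I_{sf}\sqcup D$, highly-frozen vertices $I_{hf}$, exchange matrix $\begin{pmatrix}B\\-\nu B\end{pmatrix}\in\mathbb Z^{(I\sqcup D)\times I_{uf}}$, and cluster ${\uparrow}x_i=x_i\prod_{d\in D}x_d^{\nu_{d,i}}$ for $i\in I$, ${\uparrow}x_d=x_d$ for $d\in D$. Mutation of lifting matrices. For $k\in I_{uf}$, $\mu_k(\nu)=\nu'$ is the lifting matrix on $\mu_k(t)$ (same field $\mathbb L$) with $\nu'_{\bullet,i}=\nu_{\bullet,i}$ for $i\ne k$ and $\nu'_{\bullet,k}=\max\{\nu B_{\bullet,k}^+,\nu B_{\bullet,k}^-\}-\nu_{\bullet,k}$, the maximum being componentwise. *)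

theory Defs
  imports
    Complex_Main
    "HOL-Library.FuncSet"
    "HOL-Library.Function_Algebras"
    "HOL-Library.Poly_Mapping"
    "HOL-Computational_Algebra.Polynomial"
    "Jordan_Normal_Form.Matrix"
begin

text \<open>
  Fields are types of class \<^class>\<open>field\<close>, and a field extension is a field homomorphism
  between two such types (\<^locale>\<open>field_hom\<close>). Subrings and subfields of a field are sets.
\<close>

definition is_subring :: "'a::field set \<Rightarrow> bool" where
  "is_subring R \<longleftrightarrow> 0 \<in> R \<and> 1 \<in> R \<and>
     (\<forall>a\<in>R. \<forall>b\<in>R. a + b \<in> R \<and> a * b \<in> R) \<and> (\<forall>a\<in>R. - a \<in> R)"

definition is_subfield :: "'a::field set \<Rightarrow> bool" where
  "is_subfield F \<longleftrightarrow> is_subring F \<and> (\<forall>a\<in>F. inverse a \<in> F)"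

text \<open>\<open>adjoin R S\<close> is $R[S]$ and \<open>adjoin_units R S\<close> is $R[S^{\pm 1}]$, inside the ambient field.\<close>

definition adjoin :: "'a::field set \<Rightarrow> 'a set \<Rightarrow> 'a set" where
  "adjoin R S = is_subring hull (R \<union> S)"

definition adjoin_units :: "'a::field set \<Rightarrow> 'a set \<Rightarrow> 'a set" where
  "adjoin_units R S = adjoin R (S \<union> inverse ` S)"

definition field_adjoin :: "'a::field set \<Rightarrow> 'a set \<Rightarrow> 'a set" where
  "field_adjoin F S = is_subfield hull (F \<union> S)"

text \<open>
  An element of \<^typ>\<open>('v \<Rightarrow>\<^sub>0 nat) \<Rightarrow>\<^sub>0 'a\<close> is a polynomial over \<^typ>\<open>'a\<close> in variables indexed
  by \<^typ>\<open>'v\<close>; it is evaluated at a family \<open>x\<close>, its coefficients being transported along \<open>h\<close>.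
\<close>

definition mpoly_eval ::
    "('a::zero \<Rightarrow> 'b::field) \<Rightarrow> ('v \<Rightarrow> 'b) \<Rightarrow> (('v \<Rightarrow>\<^sub>0 nat) \<Rightarrow>\<^sub>0 'a) \<Rightarrow> 'b" where
  "mpoly_eval h x p =
     (\<Sum>m\<in>Poly_Mapping.keys p. h (Poly_Mapping.lookup p m) *
        (\<Prod>i\<in>Poly_Mapping.keys m. x i ^ Poly_Mapping.lookup m i))"

definition mpoly_vars :: "(('v \<Rightarrow>\<^sub>0 nat) \<Rightarrow>\<^sub>0 'a::zero) \<Rightarrow> 'v set" where
  "mpoly_vars p = (\<Union>m\<in>Poly_Mapping.keys p. Poly_Mapping.keys m)"

definition algebraically_independent ::
    "('a::field \<Rightarrow> 'b::field) \<Rightarrow> 'v set \<Rightarrow> ('v \<Rightarrow> 'b) \<Rightarrow> bool" where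
  "algebraically_independent h J x \<longleftrightarrow>
     (\<forall>p. mpoly_vars p \<subseteq> J \<and> p \<noteq> 0 \<longrightarrow> mpoly_eval h x p \<noteq> 0)"

definition algebraic_over :: "'a::field set \<Rightarrow> 'a \<Rightarrow> bool" where
  "algebraic_over F y \<longleftrightarrow> (\<exists>p. p \<noteq> 0 \<and> (\<forall>n. coeff p n \<in> F) \<and> poly p y = 0)"

definition transcendence_basis ::
    "('a::field \<Rightarrow> 'b::field) \<Rightarrow> 'v set \<Rightarrow> ('v \<Rightarrow> 'b) \<Rightarrow> bool" where
  "transcendence_basis h J x \<longleftrightarrow> algebraically_independent h J x \<and>
     (\<forall>y. algebraic_over (field_adjoin (range h) (x ` J)) y)"

text \<open>
  Tuples and matrices are functions which are \<^const>\<open>undefined\<close> off their index set, so that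
  equality of records of type \<open>seed\<close> is equality of seeds.
\<close>

record ('v, 'k) seed =
  uf :: "'v set"
  sf :: "'v set"
  hf :: "'v set"
  exmat :: "'v \<times> 'v \<Rightarrow> int"
  cluster :: "'v \<Rightarrow> 'k"

definition vertices :: "('v, 'k) seed \<Rightarrow> 'v set" where
  "vertices t = uf t \<union> sf t \<union> hf t"

definition skew_symmetrizable :: "'v set \<Rightarrow> ('v \<times> 'v \<Rightarrow> int) \<Rightarrow> bool" where
  "skew_symmetrizable J b \<longleftrightarrow>
     (\<exists>s::'v \<Rightarrow> int. (\<forall>i\<in>J. s i > 0) \<and> (\<forall>i\<in>J. \<forall>j\<in>J. s i * b (i, j) = - (s j * b (j, i))))"

definition is_seed :: "(complex \<Rightarrow> 'k::field) \<Rightarrow> ('v, 'k) seed \<Rightarrow> bool" where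
  "is_seed c t \<longleftrightarrow>
     finite (vertices t) \<and>
     uf t \<inter> sf t = {} \<and> uf t \<inter> hf t = {} \<and> sf t \<inter> hf t = {} \<and>
     exmat t \<in> vertices t \<times> uf t \<rightarrow>\<^sub>E UNIV \<and>
     skew_symmetrizable (uf t) (exmat t) \<and>
     cluster t \<in> vertices t \<rightarrow>\<^sub>E UNIV - {0} \<and>
     transcendence_basis c (vertices t) (cluster t)"

definition pos :: "int \<Rightarrow> int" where "pos b = max b 0"

definition neg :: "int \<Rightarrow> int" where "neg b = max (- b) 0"

definition mutate :: "'v \<Rightarrow> ('v, 'k::field) seed \<Rightarrow> ('v, 'k) seed" where
  "mutate k t = (let b = exmat t; x = cluster t; I = vertices t in
     \<lparr> uf = uf t, sf = sf t, hf = hf t,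
       exmat = (\<lambda>(i, j)\<in>I \<times> uf t.
         if i = k \<or> j = k then - b (i, j)
         else b (i, j) + pos (b (i, k)) * pos (b (k, j)) - neg (b (i, k)) * neg (b (k, j))),
       cluster = (\<lambda>i\<in>I.
         if i = k
         then inverse (x k) *
              ((\<Prod>j\<in>I. x j ^ nat (pos (b (j, k)))) + (\<Prod>j\<in>I. x j ^ nat (neg (b (j, k)))))
         else x i) \<rparr>)"

text \<open>\<open>mutate_seq [k\<^sub>1, \<dots>, k\<^sub>r]\<close> is $\mu_{k_r} \circ \dots \circ \mu_{k_1}$.\<close>

definition mutate_seq :: "'v list \<Rightarrow> ('v, 'k::field) seed \<Rightarrow> ('v, 'k) seed" where
  "mutate_seq ks t = fold mutate ks t"

definition mutation_equivalent :: "('v, 'k::field) seed \<Rightarrow> ('v, 'k) seed \<Rightarrow> bool" where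
  "mutation_equivalent t t' \<longleftrightarrow> (\<exists>ks\<in>lists (uf t). t' = mutate_seq ks t)"

definition cluster_algebra :: "(complex \<Rightarrow> 'k::field) \<Rightarrow> ('v, 'k) seed \<Rightarrow> 'k set" where
  "cluster_algebra c t =
     adjoin (adjoin_units (adjoin (range c) (cluster t ` hf t)) (cluster t ` sf t))
       (\<Union>t'\<in>{t'. mutation_equivalent t t'}. cluster t' ` vertices t')"

definition laurent_ring :: "(complex \<Rightarrow> 'k::field) \<Rightarrow> ('v, 'k) seed \<Rightarrow> 'k set" where
  "laurent_ring c t =
     adjoin_units (adjoin (range c) (cluster t ` hf t)) (cluster t ` (sf t \<union> uf t))"

definition upper_cluster_algebra :: "(complex \<Rightarrow> 'k::field) \<Rightarrow> ('v, 'k) seed \<Rightarrow> 'k set" where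
  "upper_cluster_algebra c t = (\<Inter>t'\<in>{t'. mutation_equivalent t t'}. laurent_ring c t')"

text \<open>The rank over the rationals, as the dimension of the span of the columns.\<close>

definition matrix_rank :: "'v set \<Rightarrow> 'v set \<Rightarrow> ('v \<times> 'v \<Rightarrow> int) \<Rightarrow> nat" where
  "matrix_rank I J b =
     vector_space.dim (\<lambda>(r::rat) (f::'v \<Rightarrow> rat) i. r * f i)
       ((\<lambda>j i. if i \<in> I then of_int (b (i, j)) else 0) ` J)"

definition maximal_rank :: "('v, 'k) seed \<Rightarrow> bool" where
  "maximal_rank t \<longleftrightarrow>
     matrix_rank (vertices t) (uf t) (exmat t) = min (card (vertices t)) (card (uf t))"

definition pointed_extension ::
    "('k::field \<Rightarrow> 'l::field) \<Rightarrow> 'v set \<Rightarrow> ('v \<Rightarrow> 'l) \<Rightarrow> bool" where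
  "pointed_extension \<iota> D xD \<longleftrightarrow> field_hom \<iota> \<and>
     algebraically_independent \<iota> D xD \<and> field_adjoin (range \<iota>) (xD ` D) = UNIV"

definition lifting_matrices :: "'v set \<Rightarrow> ('v, 'k) seed \<Rightarrow> ('v \<times> 'v \<Rightarrow> int) set" where
  "lifting_matrices D t = D \<times> vertices t \<rightarrow>\<^sub>E UNIV"

text \<open>The index sets \<open>D\<close> and \<^term>\<open>vertices t\<close> are meant to be disjoint.\<close>

definition lift_seed ::
    "('k::field \<Rightarrow> 'l::field) \<Rightarrow> 'v set \<Rightarrow> ('v \<Rightarrow> 'l) \<Rightarrow> ('v \<times> 'v \<Rightarrow> int) \<Rightarrow>
     ('v, 'k) seed \<Rightarrow> ('v, 'l) seed" where
  "lift_seed \<iota> D xD \<nu> t = (let I = vertices t in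
     \<lparr> uf = uf t, sf = sf t \<union> D, hf = hf t,
       exmat = (\<lambda>(i, j)\<in>(I \<union> D) \<times> uf t.
         if i \<in> D then - (\<Sum>l\<in>I. \<nu> (i, l) * exmat t (l, j)) else exmat t (i, j)),
       cluster = (\<lambda>i\<in>I \<union> D.
         if i \<in> D then xD i else \<iota> (cluster t i) * (\<Prod>d\<in>D. xD d powi \<nu> (d, i))) \<rparr>)"

definition mutate_lifting ::
    "'v set \<Rightarrow> 'v \<Rightarrow> ('v, 'k) seed \<Rightarrow> ('v \<times> 'v \<Rightarrow> int) \<Rightarrow> ('v \<times> 'v \<Rightarrow> int)" where
  "mutate_lifting D k t \<nu> = (let b = exmat t; I = vertices t in
     (\<lambda>(d, i)\<in>D \<times> I.
       if i = k
       then max (\<Sum>j\<in>I. \<nu> (d, j) * pos (b (j, k))) (\<Sum>j\<in>I. \<nu> (d, j) * neg (b (j, k))) - \<nu> (d, k)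
       else \<nu> (d, i)))"

fun mutate_lifting_seq ::
    "'v set \<Rightarrow> 'v list \<Rightarrow> ('v, 'k::field) seed \<Rightarrow> ('v \<times> 'v \<Rightarrow> int) \<Rightarrow> ('v \<times> 'v \<Rightarrow> int)" where
  "mutate_lifting_seq D [] t \<nu> = \<nu>"
| "mutate_lifting_seq D (k # ks) t \<nu> =
     mutate_lifting_seq D ks (mutate k t) (mutate_lifting D k t \<nu>)"

end

theory Submission
  imports Defs
begin

text \<open>
Everything rests on the commutation of lifting with mutation, \<open>mutate_lift_seed\<close>. The rows
$-\nu B$ added to the exchange matrix make the two monomials of every lifted exchange relation carry
the same monomial in the new variables $x_d$, with exponent
$\max(\nu B^+_{\bullet,k}, \nu B^-_{\bullet,k})$; this factor is
what $\mu_k(\nu)$ records. The check is a computation that uses $b_{k,k} = 0$.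

The lifting matrix of an equivalent seed is independent of the path because it is intrinsic to the
cluster. Fix $d$ and substitute $x_i = s^{\nu_{d,i}}$ in a cluster variable, written as a
rational function of the initial cluster. It is a subtraction-free expression, hence grows like a
definite power of $s$, and the exponent obeys the max-plus version of the exchange relation,
which is the mutation rule for row $d$ of $\nu$ (\<open>growth_degree_mutate_seq\<close>). On the other
hand the function of $s$, and so the exponent, is determined by the cluster variable as an element
of the field, because the initial cluster is algebraically independent
(\<open>growth_degree_unique\<close>).

For the two algebras, the seeds equivalent to the lifted seed are the liftings of the seeds
equivalent to $t$, by iterating the commutation. A lifted cluster variable is $x_i$ times a Laurent
monomial in the $x_d$, and these are units in all the rings at hand, so the generators of the lifted
rings may be exchanged for the original generators together with the $x_d^{\pm1}$
(\<open>hull_lift\<close>). This settles the cluster algebra, and shows that the Laurent ring of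
every lifted seed is $\mathcal L(t')[x_d^{\pm1}]$. Since the $x_d$ are algebraically independent over
$\mathbb K$, coefficients of Laurent polynomials in the $x_d$ are unique, and intersecting these
rings amounts to intersecting the coefficient rings $\mathcal L(t')$ (\<open>INT_adjoin_units\<close>).
\<close>

section \<open>Evaluation of multivariate polynomials\<close>

definition monom_eval :: "('v \<Rightarrow> 'b::field) \<Rightarrow> ('v \<Rightarrow>\<^sub>0 nat) \<Rightarrow> 'b" where
  "monom_eval x m = (\<Prod>i\<in>Poly_Mapping.keys m. x i ^ Poly_Mapping.lookup m i)"

lemma monom_eval_superset:
  assumes "finite J" "Poly_Mapping.keys m \<subseteq> J"
  shows "monom_eval x m = (\<Prod>i\<in>J. x i ^ Poly_Mapping.lookup m i)"
  unfolding monom_eval_def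
  by (rule prod.mono_neutral_left) (use assms in \<open>auto simp: in_keys_iff\<close>)

lemma monom_eval_add: "monom_eval x (m + n) = monom_eval x m * monom_eval x n"
proof -
  let ?J = "Poly_Mapping.keys m \<union> Poly_Mapping.keys n"
  have "Poly_Mapping.keys (m + n) \<subseteq> ?J" by (rule keys_add)
  then show ?thesis
    by (simp add: monom_eval_superset[of ?J] lookup_add power_add prod.distrib)
qed

lemma monom_eval_zero [simp]: "monom_eval x 0 = 1"
  by (simp add: monom_eval_def)

lemma monom_eval_single [simp]: "monom_eval x (Poly_Mapping.single i n) = x i ^ n"
  by (simp add: monom_eval_def)

lemma keys_sum_single:
  "finite S \<Longrightarrow> Poly_Mapping.keys (\<Sum>d\<in>S. Poly_Mapping.single d (n d)) \<subseteq> S"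
  by (auto simp: in_keys_iff lookup_sum lookup_single when_def split: if_splits)

lemma monom_eval_sum_single:
  "monom_eval x (\<Sum>d\<in>S. Poly_Mapping.single d (n d)) = (\<Prod>d\<in>S. x d ^ n d)"
  by (induction S rule: infinite_finite_induct) (simp_all add: monom_eval_add)

lemma mpoly_eval_monom_eval:
  "mpoly_eval h x p = (\<Sum>m\<in>Poly_Mapping.keys p. h (Poly_Mapping.lookup p m) * monom_eval x m)"
  by (simp add: mpoly_eval_def monom_eval_def)

lemma poly_mapping_eq_sum_single:
  "p = (\<Sum>m\<in>Poly_Mapping.keys p. Poly_Mapping.single m (Poly_Mapping.lookup p m))"
proof (rule poly_mapping_eqI)
  fix k
  show "Poly_Mapping.lookup p k =
    Poly_Mapping.lookup (\<Sum>m\<in>Poly_Mapping.keys p. Poly_Mapping.single m (Poly_Mapping.lookup p m)) k"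
    by (cases "k \<in> Poly_Mapping.keys p")
      (auto simp: lookup_sum lookup_single when_def in_keys_iff sum.delta)
qed

lemma mpoly_vars_add: "mpoly_vars (p + q) \<subseteq> mpoly_vars p \<union> mpoly_vars q"
  using keys_add[of p q] by (auto simp: mpoly_vars_def)

lemma mpoly_vars_uminus: "mpoly_vars (- p) = mpoly_vars (p :: _ \<Rightarrow>\<^sub>0 'a::ab_group_add)"
  by (auto simp: mpoly_vars_def in_keys_iff)

lemma mpoly_vars_mult:
  fixes p q :: "('v \<Rightarrow>\<^sub>0 nat) \<Rightarrow>\<^sub>0 'a::comm_ring_1"
  shows "mpoly_vars (p * q) \<subseteq> mpoly_vars p \<union> mpoly_vars q"
proof
  fix i assume "i \<in> mpoly_vars (p * q)"
  then obtain m where m: "m \<in> Poly_Mapping.keys (p * q)" "i \<in> Poly_Mapping.keys m"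
    by (auto simp: mpoly_vars_def)
  then obtain a b where "m = a + b" "a \<in> Poly_Mapping.keys p" "b \<in> Poly_Mapping.keys q"
    using keys_mult[of p q] by blast
  with m(2) show "i \<in> mpoly_vars p \<union> mpoly_vars q"
    using keys_add[of a b] by (auto simp: mpoly_vars_def)
qed

context
  fixes h :: "'a::field \<Rightarrow> 'b::field"
  assumes h: "field_hom h"
begin

interpretation h: field_hom h by (rule h)

lemma mpoly_eval_zero: "mpoly_eval h x 0 = 0"
  by (simp add: mpoly_eval_monom_eval)

lemma mpoly_eval_add: "mpoly_eval h x (p + q) = mpoly_eval h x p + mpoly_eval h x q"
  unfolding mpoly_eval_monom_eval
  by (rule setsum_keys_plus_distrib) (auto simp: h.hom_add algebra_simps)

lemma mpoly_eval_uminus: "mpoly_eval h x (- p) = - mpoly_eval h x p"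
  using mpoly_eval_add[of x p "- p"] by (simp add: mpoly_eval_zero add_eq_0_iff)

lemma mpoly_eval_diff: "mpoly_eval h x (p - q) = mpoly_eval h x p - mpoly_eval h x q"
  using mpoly_eval_add[of x p "- q"] by (simp add: mpoly_eval_uminus)

lemma mpoly_eval_sum: "mpoly_eval h x (sum f S) = (\<Sum>s\<in>S. mpoly_eval h x (f s))"
  by (induction S rule: infinite_finite_induct) (auto simp: mpoly_eval_zero mpoly_eval_add)

lemma mpoly_eval_single: "mpoly_eval h x (Poly_Mapping.single m a) = h a * monom_eval x m"
  by (simp add: mpoly_eval_monom_eval)

lemma mpoly_eval_one: "mpoly_eval h x 1 = 1"
  using mpoly_eval_single[of x 0 1] by simp

lemma mpoly_eval_mult: "mpoly_eval h x (p * q) = mpoly_eval h x p * mpoly_eval h x q"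
proof -
  let ?s = "\<lambda>p m. Poly_Mapping.single m (Poly_Mapping.lookup p m)"
  have "p * q = (\<Sum>m\<in>Poly_Mapping.keys p. ?s p m) * (\<Sum>n\<in>Poly_Mapping.keys q. ?s q n)"
    by (simp flip: poly_mapping_eq_sum_single)
  also have "\<dots> = (\<Sum>m\<in>Poly_Mapping.keys p. \<Sum>n\<in>Poly_Mapping.keys q. ?s p m * ?s q n)"
    by (rule sum_product)
  finally have "mpoly_eval h x (p * q) = (\<Sum>m\<in>Poly_Mapping.keys p. \<Sum>n\<in>Poly_Mapping.keys q.
      (h (Poly_Mapping.lookup p m) * monom_eval x m) * (h (Poly_Mapping.lookup q n) * monom_eval x n))"
    by (simp add: mpoly_eval_sum mult_single mpoly_eval_single h.hom_mult monom_eval_add ac_simps)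
  also have "\<dots> = mpoly_eval h x p * mpoly_eval h x q"
    by (simp add: mpoly_eval_monom_eval flip: sum_product)
  finally show ?thesis .
qed

lemma mpoly_eval_inject:
  assumes "algebraically_independent h J x" "mpoly_vars p \<subseteq> J" "mpoly_vars q \<subseteq> J"
    and "mpoly_eval h x p = mpoly_eval h x q"
  shows "p = q"
proof -
  have "mpoly_vars (p - q) \<subseteq> J"
    using mpoly_vars_add[of p "- q"] assms(2,3) by (auto simp: mpoly_vars_uminus)
  moreover have "mpoly_eval h x (p - q) = 0"
    using assms(4) by (simp add: mpoly_eval_diff)
  ultimately show ?thesis
    using assms(1) unfolding algebraically_independent_def by auto
qed

lemma algebraically_independent_nonzero:
  assumes "algebraically_independent h J x" "i \<in> J"
  shows "x i \<noteq> 0"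
proof
  let ?p = "Poly_Mapping.single (Poly_Mapping.single i 1) 1 :: ('c \<Rightarrow>\<^sub>0 nat) \<Rightarrow>\<^sub>0 'a"
  assume "x i = 0"
  then have "mpoly_eval h x ?p = mpoly_eval h x 0"
    by (simp add: mpoly_eval_single mpoly_eval_zero)
  with assms(2) have "?p = 0"
    by (intro mpoly_eval_inject[OF assms(1)]) (auto simp: mpoly_vars_def)
  then have "Poly_Mapping.lookup ?p (Poly_Mapping.single i 1) = 0"
    by simp
  then show False by simp
qed

end

section \<open>The degree of a subtraction-free expression\<close>

text \<open>
Substitute $x_i = s^{\omega_i}$ for a real $s \ge 1$ in an element $y = P(x)/Q(x)$ of $\mathbb C(x)$.
The predicate says that the resulting function of $s$ is real and lies between two positive
multiples of $s^n$, so that $n$ is its order of growth. Cluster variables qualify, because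
mutation involves only sums, products and quotients. Both bounds are demanded for all $s \ge 1$,
rather than asymptotically, so that they combine under sums, products and inverses without any
limit argument.
\<close>

definition growth_degree ::
    "(complex \<Rightarrow> 'k::field) \<Rightarrow> 'v set \<Rightarrow> ('v \<Rightarrow> 'k) \<Rightarrow> ('v \<Rightarrow> int) \<Rightarrow> 'k \<Rightarrow> int \<Rightarrow> bool" where
  "growth_degree c I x \<omega> y n \<longleftrightarrow> (\<exists>P Q. mpoly_vars P \<subseteq> I \<and> mpoly_vars Q \<subseteq> I \<and>
     y * mpoly_eval c x Q = mpoly_eval c x P \<and>
     (\<exists>A B. 0 < A \<and> (\<forall>s\<ge>1. \<exists>r. A * s powi n \<le> r \<and> r \<le> B * s powi n \<and>
        mpoly_eval (\<lambda>z. z) (\<lambda>i. of_real (s powi \<omega> i)) Q \<noteq> 0 \<and>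
        mpoly_eval (\<lambda>z. z) (\<lambda>i. of_real (s powi \<omega> i)) P =
          of_real r * mpoly_eval (\<lambda>z. z) (\<lambda>i. of_real (s powi \<omega> i)) Q)))"

lemma field_hom_ident: "field_hom (\<lambda>z::'a::field. z)"
  by unfold_locales auto

lemmas eval_id = mpoly_eval_add[OF field_hom_ident] mpoly_eval_mult[OF field_hom_ident]
  mpoly_eval_one[OF field_hom_ident] mpoly_eval_zero[OF field_hom_ident]
  mpoly_eval_single[OF field_hom_ident]

context
  fixes c :: "complex \<Rightarrow> 'k::field" and I :: "'v set" and x :: "'v \<Rightarrow> 'k" and \<omega> :: "'v \<Rightarrow> int"
  assumes c: "field_hom c" and indep: "algebraically_independent c I x"
begin

abbreviation (input) at_scale :: "real \<Rightarrow> (('v \<Rightarrow>\<^sub>0 nat) \<Rightarrow>\<^sub>0 complex) \<Rightarrow> complex" where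
  "at_scale s \<equiv> mpoly_eval (\<lambda>z. z) (\<lambda>i. of_real (s powi \<omega> i))"

interpretation c: field_hom c by (rule c)

lemmas eval_c = mpoly_eval_add[OF c] mpoly_eval_mult[OF c]
  mpoly_eval_one[OF c] mpoly_eval_zero[OF c] mpoly_eval_single[OF c]

lemma growth_degreeE:
  assumes "growth_degree c I x \<omega> y n"
  obtains P Q A B where "mpoly_vars P \<subseteq> I" "mpoly_vars Q \<subseteq> I"
    "y * mpoly_eval c x Q = mpoly_eval c x P" "0 < A"
    "\<forall>s\<ge>1. \<exists>r. A * s powi n \<le> r \<and> r \<le> B * s powi n \<and>
        at_scale s Q \<noteq> 0 \<and> at_scale s P = of_real r * at_scale s Q"
  using assms unfolding growth_degree_def by blast

lemma growth_degree_var: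
  assumes "i \<in> I"
  shows "growth_degree c I x \<omega> (x i) (\<omega> i)"
  unfolding growth_degree_def
proof (intro exI conjI allI impI)
  show "mpoly_vars (Poly_Mapping.single (Poly_Mapping.single i 1) (1::complex)) \<subseteq> I"
    using assms by (simp add: mpoly_vars_def)
  show "mpoly_vars (1 :: ('v \<Rightarrow>\<^sub>0 nat) \<Rightarrow>\<^sub>0 complex) \<subseteq> I"
    by (simp add: mpoly_vars_def)
  show "x i * mpoly_eval c x 1 =
      mpoly_eval c x (Poly_Mapping.single (Poly_Mapping.single i 1) (1::complex))"
    by (simp add: eval_c)
  fix s :: real
  show "1 * s powi \<omega> i \<le> s powi \<omega> i" "s powi \<omega> i \<le> 1 * s powi \<omega> i" by simp_all
qed (simp_all add: eval_id)

lemma growth_degree_one: "growth_degree c I x \<omega> 1 0"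
  unfolding growth_degree_def
proof (intro exI[of _ 1] conjI allI impI)
  show "mpoly_vars (1 :: ('v \<Rightarrow>\<^sub>0 nat) \<Rightarrow>\<^sub>0 complex) \<subseteq> I"
    by (simp add: mpoly_vars_def)
  fix s :: real
  show "1 * s powi 0 \<le> 1" "1 \<le> 1 * s powi 0" by simp_all
qed (simp_all add: eval_id eval_c mpoly_vars_def)

lemma growth_degree_mult:
  assumes "growth_degree c I x \<omega> y n" "growth_degree c I x \<omega> z m"
  shows "growth_degree c I x \<omega> (y * z) (n + m)"
proof -
  obtain P Q A B where
    1: "mpoly_vars P \<subseteq> I" "mpoly_vars Q \<subseteq> I" "y * mpoly_eval c x Q = mpoly_eval c x P" "0 < A"
    and r: "\<forall>s\<ge>1. \<exists>r. A * s powi n \<le> r \<and> r \<le> B * s powi n \<and>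
        at_scale s Q \<noteq> 0 \<and> at_scale s P = of_real r * at_scale s Q"
    using assms(1) by (rule growth_degreeE)
  obtain P' Q' A' B' where
    2: "mpoly_vars P' \<subseteq> I" "mpoly_vars Q' \<subseteq> I" "z * mpoly_eval c x Q' = mpoly_eval c x P'" "0 < A'"
    and r': "\<forall>s\<ge>1. \<exists>r. A' * s powi m \<le> r \<and> r \<le> B' * s powi m \<and>
        at_scale s Q' \<noteq> 0 \<and> at_scale s P' = of_real r * at_scale s Q'"
    using assms(2) by (rule growth_degreeE)
  show ?thesis
    unfolding growth_degree_def
  proof (intro exI conjI; (intro allI impI)?)
    show "mpoly_vars (P * P') \<subseteq> I" "mpoly_vars (Q * Q') \<subseteq> I"
      using mpoly_vars_mult[of P P'] mpoly_vars_mult[of Q Q'] 1 2 by auto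
    show "y * z * mpoly_eval c x (Q * Q') = mpoly_eval c x (P * P')"
      by (simp add: eval_c flip: 1(3) 2(3))
    show "0 < A * A'" using 1 2 by simp
    fix s :: real assume s: "s \<ge> 1"
    obtain a where a: "A * s powi n \<le> a" "a \<le> B * s powi n" "at_scale s Q \<noteq> 0"
      "at_scale s P = of_real a * at_scale s Q" using r s by blast
    obtain b where b: "A' * s powi m \<le> b" "b \<le> B' * s powi m" "at_scale s Q' \<noteq> 0"
      "at_scale s P' = of_real b * at_scale s Q'" using r' s by blast
    have "0 < A * s powi n" "0 < A' * s powi m" using 1 2 s by simp_all
    then have "(A * s powi n) * (A' * s powi m) \<le> a * b" "a * b \<le> (B * s powi n) * (B' * s powi m)"
      using a b by (intro mult_mono; linarith)+
    then have "A * A' * s powi (n + m) \<le> a * b" "a * b \<le> B * B' * s powi (n + m)"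
      using s by (simp_all add: power_int_add ac_simps)
    moreover have "at_scale s (Q * Q') \<noteq> 0" using a b by (simp add: eval_id)
    moreover have "at_scale s (P * P') = of_real (a * b) * at_scale s (Q * Q')"
      using a b by (simp add: eval_id)
    ultimately show "\<exists>r. A * A' * s powi (n + m) \<le> r \<and> r \<le> B * B' * s powi (n + m) \<and>
        at_scale s (Q * Q') \<noteq> 0 \<and> at_scale s (P * P') = of_real r * at_scale s (Q * Q')"
      by blast
  qed
qed

text \<open>
The sum of two positive functions has no cancellation of leading terms: its order of growth is
exactly the maximum. For general polynomials the maximum would only be an upper bound.
\<close>

lemma growth_degree_add:
  assumes "growth_degree c I x \<omega> y n" "growth_degree c I x \<omega> z m"
  shows "growth_degree c I x \<omega> (y + z) (max n m)"
proof -
  obtain P Q A B where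
    1: "mpoly_vars P \<subseteq> I" "mpoly_vars Q \<subseteq> I" "y * mpoly_eval c x Q = mpoly_eval c x P" "0 < A"
    and r: "\<forall>s\<ge>1. \<exists>r. A * s powi n \<le> r \<and> r \<le> B * s powi n \<and>
        at_scale s Q \<noteq> 0 \<and> at_scale s P = of_real r * at_scale s Q"
    using assms(1) by (rule growth_degreeE)
  obtain P' Q' A' B' where
    2: "mpoly_vars P' \<subseteq> I" "mpoly_vars Q' \<subseteq> I" "z * mpoly_eval c x Q' = mpoly_eval c x P'" "0 < A'"
    and r': "\<forall>s\<ge>1. \<exists>r. A' * s powi m \<le> r \<and> r \<le> B' * s powi m \<and>
        at_scale s Q' \<noteq> 0 \<and> at_scale s P' = of_real r * at_scale s Q'"
    using assms(2) by (rule growth_degreeE)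
  show ?thesis
    unfolding growth_degree_def
  proof (intro exI conjI; (intro allI impI)?)
    show "mpoly_vars (P * Q' + P' * Q) \<subseteq> I" "mpoly_vars (Q * Q') \<subseteq> I"
      using mpoly_vars_mult[of P Q'] mpoly_vars_mult[of P' Q] mpoly_vars_mult[of Q Q']
        mpoly_vars_add[of "P * Q'" "P' * Q"] 1 2 by blast+
    show "(y + z) * mpoly_eval c x (Q * Q') = mpoly_eval c x (P * Q' + P' * Q)"
      by (simp add: eval_c algebra_simps flip: 1(3) 2(3))
    show "0 < min A A'" using 1 2 by simp
    fix s :: real assume s: "s \<ge> 1"
    obtain a where a: "A * s powi n \<le> a" "a \<le> B * s powi n" "at_scale s Q \<noteq> 0"
      "at_scale s P = of_real a * at_scale s Q" using r s by blast
    obtain b where b: "A' * s powi m \<le> b" "b \<le> B' * s powi m" "at_scale s Q' \<noteq> 0"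
      "at_scale s P' = of_real b * at_scale s Q'" using r' s by blast
    let ?M = "s powi max n m"
    have pos: "0 < A * s powi n" "0 < A' * s powi m" "0 < s powi n" "0 < s powi m" using 1 2 s by simp_all
    have "0 < B * s powi n" "0 < B' * s powi m" using a b pos by linarith+
    then have B: "0 < B" "0 < B'" using pos by (simp_all add: zero_less_mult_iff)
    have le: "s powi n \<le> ?M" "s powi m \<le> ?M" using s by (auto intro!: power_int_increasing)
    have M: "?M = s powi n \<or> ?M = s powi m" by (auto simp: max_def)
    have "min A A' * s powi n \<le> A * s powi n" "min A A' * s powi m \<le> A' * s powi m"
      using pos by (auto intro!: mult_right_mono)
    then have "min A A' * ?M \<le> a + b"
      using M a(1) b(1) pos by (elim disjE) linarith+
    moreover have "B * s powi n \<le> B * ?M" "B' * s powi m \<le> B' * ?M"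
      using B le by (auto intro!: mult_left_mono)
    then have "a + b \<le> (B + B') * ?M"
      using a b by (simp add: distrib_right)
    moreover have "at_scale s (Q * Q') \<noteq> 0" using a b by (simp add: eval_id)
    moreover have "at_scale s (P * Q' + P' * Q) = of_real (a + b) * at_scale s (Q * Q')"
      using a b by (simp add: eval_id algebra_simps)
    ultimately show "\<exists>r. min A A' * ?M \<le> r \<and> r \<le> (B + B') * ?M \<and>
        at_scale s (Q * Q') \<noteq> 0 \<and> at_scale s (P * Q' + P' * Q) = of_real r * at_scale s (Q * Q')"
      by blast
  qed
qed

text \<open>
The value at $s = 1$ is nonzero, hence so is the numerator as a polynomial, and by algebraic
independence the element itself.
\<close>

lemma growth_degree_inverse:
  assumes "growth_degree c I x \<omega> y n"
  shows "growth_degree c I x \<omega> (inverse y) (- n)"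
proof -
  obtain P Q A B where
    1: "mpoly_vars P \<subseteq> I" "mpoly_vars Q \<subseteq> I" "y * mpoly_eval c x Q = mpoly_eval c x P" "0 < A"
    and r: "\<forall>s\<ge>1. \<exists>r. A * s powi n \<le> r \<and> r \<le> B * s powi n \<and>
        at_scale s Q \<noteq> 0 \<and> at_scale s P = of_real r * at_scale s Q"
    using assms by (rule growth_degreeE)
  obtain a where a: "A \<le> a" "a \<le> B" "at_scale 1 Q \<noteq> 0" "at_scale 1 P = of_real a * at_scale 1 Q"
    using r[rule_format, of 1] by auto
  have "P \<noteq> 0" using a 1 by (auto simp: eval_id)
  then have "mpoly_eval c x P \<noteq> 0"
    using indep 1(1) unfolding algebraically_independent_def by blast
  then have y: "y \<noteq> 0" using 1(3) by auto
  have B: "0 < B" using a 1 by linarith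
  show ?thesis
    unfolding growth_degree_def
  proof (intro exI conjI; (intro allI impI)?)
    show "mpoly_vars Q \<subseteq> I" "mpoly_vars P \<subseteq> I" by fact+
    show "inverse y * mpoly_eval c x P = mpoly_eval c x Q"
      using y by (simp flip: 1(3))
    show "0 < inverse B" using B by simp
    fix s :: real assume s: "s \<ge> 1"
    obtain a where a: "A * s powi n \<le> a" "a \<le> B * s powi n" "at_scale s Q \<noteq> 0"
      "at_scale s P = of_real a * at_scale s Q" using r s by blast
    have "0 < A * s powi n" using 1 s by simp
    with a(1) have a0: "0 < a" by linarith
    have "inverse (B * s powi n) \<le> inverse a" "inverse a \<le> inverse (A * s powi n)"
      using a a0 \<open>0 < A * s powi n\<close> by (auto intro!: le_imp_inverse_le simp del: inverse_mult_distrib)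
    then have "inverse B * s powi (- n) \<le> inverse a" "inverse a \<le> inverse A * s powi (- n)"
      by (simp_all only: power_int_minus inverse_mult_distrib)
    moreover have "at_scale s P \<noteq> 0" using a a0 by simp
    moreover have "at_scale s Q = of_real (inverse a) * at_scale s P"
      using a a0 by simp
    ultimately show "\<exists>r. inverse B * s powi (- n) \<le> r \<and> r \<le> inverse A * s powi (- n) \<and>
        at_scale s P \<noteq> 0 \<and> at_scale s Q = of_real r * at_scale s P"
      by blast
  qed
qed

lemma growth_degree_power:
  "growth_degree c I x \<omega> y n \<Longrightarrow> growth_degree c I x \<omega> (y ^ k) (n * int k)"
proof (induction k)
  case 0
  then show ?case using growth_degree_one by simp
next
  case (Suc k)
  then show ?case using growth_degree_mult[of y n "y ^ k" "n * int k"] by (simp add: algebra_simps)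
qed

lemma growth_degree_prod:
  assumes "\<And>j. j \<in> J \<Longrightarrow> growth_degree c I x \<omega> (f j) (n j)"
  shows "growth_degree c I x \<omega> (prod f J) (sum n J)"
  using assms
  by (induction J rule: infinite_finite_induct)
    (auto intro!: growth_degree_one growth_degree_mult)

text \<open>
Two representations of $y$ as a quotient satisfy $P Q' = P' Q$ as polynomials, by algebraic
independence, and so define the same function of $s$; then $s^n$ is bounded by a constant multiple
of $s^m$.
\<close>

lemma growth_degree_le:
  assumes "growth_degree c I x \<omega> y n" "growth_degree c I x \<omega> y m"
  shows "n \<le> m"
proof (rule ccontr)
  assume "\<not> n \<le> m"
  obtain P Q A B where
    1: "mpoly_vars P \<subseteq> I" "mpoly_vars Q \<subseteq> I" "y * mpoly_eval c x Q = mpoly_eval c x P" "0 < A"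
    and r: "\<forall>s\<ge>1. \<exists>r. A * s powi n \<le> r \<and> r \<le> B * s powi n \<and>
        at_scale s Q \<noteq> 0 \<and> at_scale s P = of_real r * at_scale s Q"
    using assms(1) by (rule growth_degreeE)
  obtain P' Q' A' B' where
    2: "mpoly_vars P' \<subseteq> I" "mpoly_vars Q' \<subseteq> I" "y * mpoly_eval c x Q' = mpoly_eval c x P'" "0 < A'"
    and r': "\<forall>s\<ge>1. \<exists>r. A' * s powi m \<le> r \<and> r \<le> B' * s powi m \<and>
        at_scale s Q' \<noteq> 0 \<and> at_scale s P' = of_real r * at_scale s Q'"
    using assms(2) by (rule growth_degreeE)
  have "P * Q' = P' * Q"
  proof (rule mpoly_eval_inject[OF c indep])
    show "mpoly_vars (P * Q') \<subseteq> I" "mpoly_vars (P' * Q) \<subseteq> I"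
      using mpoly_vars_mult[of P Q'] mpoly_vars_mult[of P' Q] 1 2 by auto
    show "mpoly_eval c x (P * Q') = mpoly_eval c x (P' * Q)"
      by (simp add: eval_c flip: 1(3) 2(3))
  qed
  then have eq: "at_scale s P * at_scale s Q' = at_scale s P' * at_scale s Q" for s
    by (simp flip: eval_id(2))
  \<comment> \<open>If $n > m$, the bounds force $A s \le B'$, which fails for this $s$.\<close>
  define s where "s = 1 + \<bar>B'\<bar> / A"
  have s: "s \<ge> 1" using 1 by (simp add: s_def)
  obtain a where a: "A * s powi n \<le> a" "a \<le> B * s powi n" "at_scale s Q \<noteq> 0"
    "at_scale s P = of_real a * at_scale s Q" using r s by blast
  obtain b where b: "A' * s powi m \<le> b" "b \<le> B' * s powi m" "at_scale s Q' \<noteq> 0"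
    "at_scale s P' = of_real b * at_scale s Q'" using r' s by blast
  have "a = b" using eq[of s] a(3,4) b(3,4) by simp
  then have "A * s powi n \<le> B' * s powi m" using a b by simp
  moreover have "s powi n = s powi (n - m) * s powi m"
    using s by (simp flip: power_int_add)
  ultimately have "A * s powi (n - m) * s powi m \<le> B' * s powi m" by (simp add: mult.assoc)
  then have "A * s powi (n - m) \<le> B'" using s by simp
  moreover have "s powi 1 \<le> s powi (n - m)"
    using s \<open>\<not> n \<le> m\<close> by (intro power_int_increasing) auto
  then have "A * s \<le> A * s powi (n - m)" using 1 by simp
  moreover have "A * s > B'" using 1 by (simp add: s_def distrib_left)
  ultimately show False by linarith
qed

lemma growth_degree_unique:
  assumes "growth_degree c I x \<omega> y n" "growth_degree c I x \<omega> y m"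
  shows "n = m"
  using growth_degree_le[OF assms] growth_degree_le[OF assms(2,1)] by simp

end

section \<open>Subrings\<close>

lemma is_subring_hull: "is_subring (is_subring hull S)"
  by (rule hull_in) (auto simp: is_subring_def)

lemma subset_adjoin: "R \<subseteq> adjoin R S" "S \<subseteq> adjoin R S"
  unfolding adjoin_def by (meson Un_subset_iff hull_subset)+

lemma subset_adjoin_units:
  "R \<subseteq> adjoin_units R S" "S \<subseteq> adjoin_units R S" "inverse ` S \<subseteq> adjoin_units R S"
  unfolding adjoin_units_def
  using subset_adjoin[of R "S \<union> inverse ` S"] subset_adjoin(2)[of "S \<union> inverse ` S" R] by auto

lemma is_subring_adjoin_units: "is_subring (adjoin_units R S)"
  by (simp add: adjoin_units_def adjoin_def is_subring_hull)

lemma adjoin_units_least: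
  "is_subring T \<Longrightarrow> R \<subseteq> T \<Longrightarrow> S \<subseteq> T \<Longrightarrow> inverse ` S \<subseteq> T \<Longrightarrow> adjoin_units R S \<subseteq> T"
  unfolding adjoin_units_def adjoin_def by (rule hull_minimal) auto

lemma subring_hull_absorb: "is_subring hull (is_subring hull A \<union> B) = is_subring hull (A \<union> B)"
proof (rule antisym)
  have "is_subring hull A \<subseteq> is_subring hull (A \<union> B)" by (rule hull_mono) simp
  moreover have "B \<subseteq> is_subring hull (A \<union> B)" using hull_subset[of "A \<union> B" is_subring] by simp
  ultimately show "is_subring hull (is_subring hull A \<union> B) \<subseteq> is_subring hull (A \<union> B)"
    by (intro hull_minimal is_subring_hull) simp
  show "is_subring hull (A \<union> B) \<subseteq> is_subring hull (is_subring hull A \<union> B)"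
    using hull_subset[of A is_subring] by (intro hull_mono) auto
qed

lemma subring_sum: "is_subring T \<Longrightarrow> (\<And>j. j \<in> J \<Longrightarrow> f j \<in> T) \<Longrightarrow> sum f J \<in> T"
  by (induction J rule: infinite_finite_induct) (auto simp: is_subring_def)

lemma subring_prod: "is_subring T \<Longrightarrow> (\<And>j. j \<in> J \<Longrightarrow> f j \<in> T) \<Longrightarrow> prod f J \<in> T"
  by (induction J rule: infinite_finite_induct) (auto simp: is_subring_def)

lemma subring_power: "is_subring T \<Longrightarrow> y \<in> T \<Longrightarrow> y ^ n \<in> T"
  by (induction n) (auto simp: is_subring_def)

lemma subring_power_int: "is_subring T \<Longrightarrow> y \<in> T \<Longrightarrow> inverse y \<in> T \<Longrightarrow> y powi n \<in> T"
  by (auto simp: power_int_def subring_power simp flip: power_inverse)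

lemma subring_mult: "is_subring T \<Longrightarrow> y \<in> T \<Longrightarrow> z \<in> T \<Longrightarrow> y * z \<in> T"
  by (simp add: is_subring_def)

lemma subring_mult_unit_iff:
  assumes "is_subring T" "u \<in> T" "inverse u \<in> T" "u \<noteq> 0"
  shows "y * u \<in> T \<longleftrightarrow> y \<in> T"
  using subring_mult[OF assms(1) _ assms(3), of "y * u"] subring_mult[OF assms(1) _ assms(2), of y]
    assms(4) by (auto simp: mult.assoc)

lemma subring_vimage:
  assumes "field_hom h" "is_subring T"
  shows "is_subring (h -` T)"
proof -
  interpret h: field_hom h by (rule assms(1))
  show ?thesis
    using assms(2) by (auto simp: is_subring_def h.hom_add h.hom_mult h.hom_uminus)
qed

section \<open>Mutation\<close>

text \<open>
The combinatorial part of being a seed. What the identities between a seed and its lifting call for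
is $b_{k,k} = 0$ at every step; skew-symmetrizability implies it and is stable under mutation,
while a zero diagonal on its own is not.
\<close>

definition exchange_seed :: "('v, 'k) seed \<Rightarrow> bool" where
  "exchange_seed t \<longleftrightarrow> finite (vertices t) \<and> skew_symmetrizable (uf t) (exmat t)"

lemma uf_subset_vertices: "uf t \<subseteq> vertices t" "sf t \<subseteq> vertices t" "hf t \<subseteq> vertices t"
  by (auto simp: vertices_def)

lemma mutate_simps [simp]:
  "uf (mutate k t) = uf t" "sf (mutate k t) = sf t" "hf (mutate k t) = hf t"
  "vertices (mutate k t) = vertices t"
  by (simp_all add: mutate_def Let_def vertices_def)

lemma exmat_mutate:
  assumes "i \<in> vertices t" "j \<in> uf t"
  shows "exmat (mutate k t) (i, j) = (if i = k \<or> j = k then - exmat t (i, j)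
    else exmat t (i, j) + pos (exmat t (i, k)) * pos (exmat t (k, j))
      - neg (exmat t (i, k)) * neg (exmat t (k, j)))"
  using assms by (simp add: mutate_def Let_def)

lemma cluster_mutate:
  assumes "i \<in> vertices t"
  shows "cluster (mutate k t) i = (if i = k
    then inverse (cluster t k) *
      ((\<Prod>j\<in>vertices t. cluster t j ^ nat (pos (exmat t (j, k)))) +
       (\<Prod>j\<in>vertices t. cluster t j ^ nat (neg (exmat t (j, k)))))
    else cluster t i)"
  using assms by (simp add: mutate_def Let_def)

lemma pos_nonneg [simp]: "0 \<le> pos b" and neg_nonneg [simp]: "0 \<le> neg b"
  by (simp_all add: pos_def neg_def)

lemma pos_minus_neg: "pos b - neg b = b"
  by (simp add: pos_def neg_def)

lemma pos_uminus: "pos (- b) = neg b"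
  by (simp add: pos_def neg_def)

lemma pos_scale: "0 < a \<Longrightarrow> pos (a * b) = a * pos b"
  and neg_scale: "0 < a \<Longrightarrow> neg (a * b) = a * neg b"
  by (auto simp: pos_def neg_def max_def zero_le_mult_iff mult_le_0_iff)

lemma skew_symmetrizable_diagonal:
  assumes "skew_symmetrizable J b" "k \<in> J"
  shows "b (k, k) = 0"
proof -
  obtain s where "s k > 0" "s k * b (k, k) = - (s k * b (k, k))"
    using assms unfolding skew_symmetrizable_def by blast
  then show ?thesis by simp
qed

lemma exchange_seed_mutate:
  assumes "exchange_seed t" "k \<in> uf t"
  shows "exchange_seed (mutate k t)"
proof -
  define b where "b = exmat t"
  obtain s where s: "\<And>i. i \<in> uf t \<Longrightarrow> s i > 0"
    and skew: "\<And>i j. i \<in> uf t \<Longrightarrow> j \<in> uf t \<Longrightarrow> s i * b (i, j) = - (s j * b (j, i))"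
    using assms(1) unfolding exchange_seed_def skew_symmetrizable_def b_def by blast
  \<comment> \<open>Two swaps turn $s_i b_{i,k}^+ b_{k,j}^+$ into $s_j b_{j,k}^- b_{k,i}^-$, so the two correction
    terms of a mutated entry are exchanged by transposition, up to the scaling.\<close>
  have swap: "s i * pos (b (i, j)) = s j * neg (b (j, i))" if "i \<in> uf t" "j \<in> uf t" for i j
    using skew[OF that] s[OF that(1)] s[OF that(2)]
    by (simp add: pos_uminus flip: pos_scale neg_scale)
  have mem: "i \<in> vertices t" if "i \<in> uf t" for i
    using that by (simp add: vertices_def)
  have "s i * exmat (mutate k t) (i, j) = - (s j * exmat (mutate k t) (j, i))"
    if ij: "i \<in> uf t" "j \<in> uf t" for i j
  proof (cases "i = k \<or> j = k")
    case True
    then show ?thesis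
      using skew[OF ij] ij mem by (auto simp: exmat_mutate b_def)
  next
    case False
    have "s i * (pos (b (i, k)) * pos (b (k, j))) = s j * (neg (b (j, k)) * neg (b (k, i)))"
    proof -
      have "s i * (pos (b (i, k)) * pos (b (k, j))) = neg (b (k, i)) * (s k * pos (b (k, j)))"
        using swap[of i k] ij assms(2) by simp
      also have "\<dots> = s j * (neg (b (j, k)) * neg (b (k, i)))"
        using swap[of k j] ij assms(2) by simp
      finally show ?thesis .
    qed
    moreover have "s j * (pos (b (j, k)) * pos (b (k, i))) = s i * (neg (b (i, k)) * neg (b (k, j)))"
    proof -
      have "s j * (pos (b (j, k)) * pos (b (k, i))) = neg (b (k, j)) * (s k * pos (b (k, i)))"
        using swap[of j k] ij assms(2) by simp
      also have "\<dots> = s i * (neg (b (i, k)) * neg (b (k, j)))"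
        using swap[of k i] ij assms(2) by simp
      finally show ?thesis .
    qed
    ultimately show ?thesis
      using skew[OF ij] False ij mem
      by (auto simp: exmat_mutate algebra_simps simp flip: b_def)
  qed
  with s assms(1) show ?thesis
    unfolding exchange_seed_def skew_symmetrizable_def by auto
qed

lemma mutate_seq_simps [simp]:
  "mutate_seq [] t = t" "mutate_seq (k # ks) t = mutate_seq ks (mutate k t)"
  by (simp_all add: mutate_seq_def)

lemma mutate_seq_vertices [simp]:
  "uf (mutate_seq ks t) = uf t" "sf (mutate_seq ks t) = sf t" "hf (mutate_seq ks t) = hf t"
  "vertices (mutate_seq ks t) = vertices t"
  by (induction ks arbitrary: t) simp_all

section \<open>Mutation of lifting matrices is tropical mutation\<close>

lemma mutate_lifting_apply:
  assumes "d \<in> D" "i \<in> vertices t"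
  shows "mutate_lifting D k t \<nu> (d, i) =
    (if i = k then max (\<Sum>j\<in>vertices t. \<nu> (d, j) * pos (exmat t (j, k)))
       (\<Sum>j\<in>vertices t. \<nu> (d, j) * neg (exmat t (j, k))) - \<nu> (d, k)
     else \<nu> (d, i))"
  using assms by (simp add: mutate_lifting_def Let_def)

lemma mutate_lifting_mem: "mutate_lifting D k t \<nu> \<in> lifting_matrices D (mutate k t)"
  by (auto simp: mutate_lifting_def lifting_matrices_def Let_def)

lemma mutate_lifting_seq_mem:
  "\<nu> \<in> lifting_matrices D t \<Longrightarrow>
   mutate_lifting_seq D ks t \<nu> \<in> lifting_matrices D (mutate_seq ks t)"
  by (induction ks arbitrary: t \<nu>) (simp_all add: mutate_lifting_mem)

text \<open>
The rule $\nu'_{d,k} = \max(\sum_j \nu_{d,j} b_{j,k}^+, \sum_j \nu_{d,j} b_{j,k}^-) - \nu_{d,k}$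
is the exchange relation with product, sum and inverse replaced by sum, maximum and negation,
which is how orders of growth behave. So entry $(d,i)$ of the mutated lifting matrix is the degree
of the $i$-th cluster variable for the weights prescribed by row $d$.
\<close>

lemma growth_degree_mutate_seq:
  fixes c :: "complex \<Rightarrow> 'k::field" and t :: "('v, 'k) seed"
  assumes c: "field_hom c" and indep: "algebraically_independent c I x" and "d \<in> D"
    and "\<And>i. i \<in> vertices t \<Longrightarrow> growth_degree c I x \<omega> (cluster t i) (\<nu> (d, i))"
    and "set ks \<subseteq> vertices t" "i \<in> vertices t"
  shows "growth_degree c I x \<omega> (cluster (mutate_seq ks t) i) (mutate_lifting_seq D ks t \<nu> (d, i))"
  using assms(4-)
proof (induction ks arbitrary: t \<nu>)
  case Nil
  then show ?case by simp
next
  case (Cons k ks)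
  note growth = growth_degree_mult[OF c indep] growth_degree_add[OF c indep]
    growth_degree_inverse[OF c indep] growth_degree_power[OF c indep] growth_degree_prod[OF c indep]
  have monomial: "growth_degree c I x \<omega> (\<Prod>j\<in>vertices t. cluster t j ^ nat (e j))
      (\<Sum>j\<in>vertices t. \<nu> (d, j) * e j)" if "\<And>j. 0 \<le> e j" for e :: "'v \<Rightarrow> int"
  proof (rule growth)
    fix j assume "j \<in> vertices t"
    then have "growth_degree c I x \<omega> (cluster t j ^ nat (e j)) (\<nu> (d, j) * int (nat (e j)))"
      by (intro growth Cons.prems)
    then show "growth_degree c I x \<omega> (cluster t j ^ nat (e j)) (\<nu> (d, j) * e j)"
      using that by simp
  qed
  have "growth_degree c I x \<omega> (cluster (mutate k t) j) (mutate_lifting D k t \<nu> (d, j))"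
    if j: "j \<in> vertices t" for j
  proof (cases "j = k")
    case True
    have "growth_degree c I x \<omega> (inverse (cluster t k) *
        ((\<Prod>j\<in>vertices t. cluster t j ^ nat (pos (exmat t (j, k)))) +
         (\<Prod>j\<in>vertices t. cluster t j ^ nat (neg (exmat t (j, k))))))
        (- \<nu> (d, k) + max (\<Sum>j\<in>vertices t. \<nu> (d, j) * pos (exmat t (j, k)))
          (\<Sum>j\<in>vertices t. \<nu> (d, j) * neg (exmat t (j, k))))"
      using j True by (intro growth monomial Cons.prems) auto
    then show ?thesis
      using j True \<open>d \<in> D\<close> by (simp add: cluster_mutate mutate_lifting_apply)
  next
    case False
    then show ?thesis
      using j \<open>d \<in> D\<close> Cons.prems(1) by (simp add: cluster_mutate mutate_lifting_apply)
  qed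
  with Cons.prems(2,3) show ?case
    by (auto intro!: Cons.IH)
qed

text \<open>
The degree of an element of the field depends on the element only, not on the
sequence of mutations that produced it.
\<close>

lemma mutate_lifting_seq_unique:
  fixes c :: "complex \<Rightarrow> 'k::field" and t :: "('v, 'k) seed"
  assumes c: "field_hom c" and indep: "algebraically_independent c (vertices t) (cluster t)"
    and \<nu>: "\<nu> \<in> lifting_matrices D t"
    and ks: "ks \<in> lists (uf t)" and js: "js \<in> lists (uf t)"
    and eq: "mutate_seq ks t = mutate_seq js t"
  shows "mutate_lifting_seq D ks t \<nu> = mutate_lifting_seq D js t \<nu>"
proof -
  have "mutate_lifting_seq D ks t \<nu> (d, i) = mutate_lifting_seq D js t \<nu> (d, i)"
    if d: "d \<in> D" and i: "i \<in> vertices t" for d i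
  proof -
    have *: "growth_degree c (vertices t) (cluster t) (\<lambda>i. \<nu> (d, i))
        (cluster (mutate_seq ls t) i) (mutate_lifting_seq D ls t \<nu> (d, i))"
      if "ls \<in> lists (uf t)" for ls
      using that uf_subset_vertices[of t]
      by (intro growth_degree_mutate_seq[OF c indep d] i growth_degree_var[OF c indep]) auto
    show ?thesis
      using growth_degree_unique[OF c indep *[OF ks]] *[OF js] by (simp add: eq)
  qed
  moreover have "mutate_lifting_seq D ks t \<nu> \<in> D \<times> vertices t \<rightarrow>\<^sub>E UNIV"
    "mutate_lifting_seq D js t \<nu> \<in> D \<times> vertices t \<rightarrow>\<^sub>E UNIV"
    using mutate_lifting_seq_mem[OF \<nu>, of ks] mutate_lifting_seq_mem[OF \<nu>, of js]
    by (auto simp: lifting_matrices_def)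
  ultimately show ?thesis
    by (intro PiE_ext) auto
qed

section \<open>Lifting commutes with mutation\<close>

definition laurent_monomial :: "'v set \<Rightarrow> ('v \<Rightarrow> 'l::field) \<Rightarrow> ('v \<Rightarrow> int) \<Rightarrow> 'l" where
  "laurent_monomial D z n = (\<Prod>d\<in>D. z d powi n d)"

lemma inverse_laurent_monomial:
  "inverse (laurent_monomial D z n) = laurent_monomial D z (\<lambda>d. - n d)"
  by (simp add: laurent_monomial_def power_int_minus flip: prod_inversef)

lemma laurent_monomial_power:
  "laurent_monomial D z n ^ k = laurent_monomial D z (\<lambda>d. n d * int k)"
  by (simp add: laurent_monomial_def prod_power_distrib power_int_mult)

lemma subring_laurent_monomial:
  assumes "is_subring T" "z ` D \<subseteq> T" "inverse ` z ` D \<subseteq> T"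
  shows "laurent_monomial D z n \<in> T"
  unfolding laurent_monomial_def
  using assms by (intro subring_prod subring_power_int) auto

locale monomial_lifting =
  fixes \<iota> :: "'k::field \<Rightarrow> 'l::field" and D :: "'v set" and xD :: "'v \<Rightarrow> 'l"
  assumes hom: "field_hom \<iota>" and finite_D: "finite D"
    and indep: "algebraically_independent \<iota> D xD"
begin

sublocale \<iota>: field_hom \<iota> by (rule hom)

abbreviation (input) mon :: "('v \<Rightarrow> int) \<Rightarrow> 'l" where "mon \<equiv> laurent_monomial D xD"

lemma xD_nonzero: "d \<in> D \<Longrightarrow> xD d \<noteq> 0"
  using algebraically_independent_nonzero[OF hom indep] .

lemma mon_nonzero: "mon n \<noteq> 0"
  using xD_nonzero finite_D by (auto simp: laurent_monomial_def)

lemma mon_mult: "mon n * mon m = mon (\<lambda>d. n d + m d)"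
  using xD_nonzero by (simp add: laurent_monomial_def power_int_add flip: prod.distrib)

lemma mon_prod: "(\<Prod>j\<in>J. mon (n j)) = mon (\<lambda>d. \<Sum>j\<in>J. n j d)"
  by (induction J rule: infinite_finite_induct)
    (simp_all add: mon_mult, simp_all add: laurent_monomial_def)

lemma lift_seed_simps [simp]:
  "uf (lift_seed \<iota> D xD \<nu> t) = uf t" "sf (lift_seed \<iota> D xD \<nu> t) = sf t \<union> D"
  "hf (lift_seed \<iota> D xD \<nu> t) = hf t" "vertices (lift_seed \<iota> D xD \<nu> t) = vertices t \<union> D"
  by (auto simp: lift_seed_def Let_def vertices_def)

lemma cluster_lift_D: "d \<in> D \<Longrightarrow> cluster (lift_seed \<iota> D xD \<nu> t) d = xD d"
  by (simp add: lift_seed_def Let_def)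

lemma cluster_lift:
  "i \<in> vertices t \<Longrightarrow> i \<notin> D \<Longrightarrow>
   cluster (lift_seed \<iota> D xD \<nu> t) i = \<iota> (cluster t i) * mon (\<lambda>d. \<nu> (d, i))"
  by (simp add: lift_seed_def Let_def laurent_monomial_def)

lemma exmat_lift:
  "i \<in> vertices t \<union> D \<Longrightarrow> j \<in> uf t \<Longrightarrow> exmat (lift_seed \<iota> D xD \<nu> t) (i, j) =
    (if i \<in> D then - (\<Sum>l\<in>vertices t. \<nu> (i, l) * exmat t (l, j)) else exmat t (i, j))"
  by (auto simp: lift_seed_def Let_def)

text \<open>
Mutating row $d$ of the block $-\nu B$ gives row $d$ of $-\nu' B'$: for $j \ne k$ and with
$P = (\nu B^+)_{d,k}$ and $N = (\nu B^-)_{d,k}$, the entry of $\nu' B'$ exceeds that of $\nu B$ by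
$P\,b_{k,j}^+ - N\,b_{k,j}^- - \max(P,N)\,b_{k,j}$, and $\max(P,N) - P$, $\max(P,N) - N$ are the
positive and negative parts of $N - P = -(\nu B)_{d,k}$.
\<close>

lemma lifted_rows_mutate:
  fixes \<nu> :: "'v \<times> 'v \<Rightarrow> int" and t :: "('v, 'k) seed"
  assumes t: "exchange_seed t" and k: "k \<in> uf t" and j: "j \<in> uf t" and d: "d \<in> D"
  defines "V \<equiv> \<lambda>j. \<Sum>l\<in>vertices t. \<nu> (d, l) * exmat t (l, j)"
  shows "(\<Sum>l\<in>vertices t. mutate_lifting D k t \<nu> (d, l) * exmat (mutate k t) (l, j)) =
    (if j = k then - V k
     else V j - pos (- V k) * pos (exmat t (k, j)) + neg (- V k) * neg (exmat t (k, j)))"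
proof -
  let ?I = "vertices t"
  define b where "b = exmat t"
  define P where "P = (\<Sum>l\<in>?I. \<nu> (d, l) * pos (b (l, k)))"
  define N where "N = (\<Sum>l\<in>?I. \<nu> (d, l) * neg (b (l, k)))"
  have fin: "finite ?I" and kI: "k \<in> ?I"
    using t k uf_subset_vertices[of t] by (auto simp: exchange_seed_def)
  have bkk: "b (k, k) = 0"
    using t skew_symmetrizable_diagonal[of "uf t" "exmat t" k, OF _ k] by (simp add: exchange_seed_def b_def)
  have V: "V k = P - N"
    unfolding V_def P_def N_def b_def[symmetric] sum_subtractf[symmetric] right_diff_distrib[symmetric]
    by (simp add: pos_minus_neg)
  note app = exmat_mutate mutate_lifting_apply[OF d]
  show ?thesis
  proof (cases "j = k")
    case True
    have "(\<Sum>l\<in>?I. mutate_lifting D k t \<nu> (d, l) * exmat (mutate k t) (l, j)) =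
        (\<Sum>l\<in>?I. - (\<nu> (d, l) * b (l, k)))"
      using True bkk k by (intro sum.cong) (auto simp: app b_def)
    then show ?thesis using True by (simp add: V_def b_def sum_negf)
  next
    case False
    let ?b = "b (k, j)"
    \<comment> \<open>The summand for $l = k$ is the only irregular one: it is $-(\max(P,N) - \nu_{d,k})\,b_{k,j}$,
      while the regular expression gives $\nu_{d,k}\,b_{k,j}$ there since $b_{k,k} = 0$.\<close>
    have "(\<Sum>l\<in>?I. mutate_lifting D k t \<nu> (d, l) * exmat (mutate k t) (l, j)) =
        (\<Sum>l\<in>?I. \<nu> (d, l) * (b (l, j) + pos (b (l, k)) * pos ?b - neg (b (l, k)) * neg ?b)
          + (if l = k then - max P N * ?b else 0))"
      using False bkk j k
      by (intro sum.cong) (auto simp: app P_def N_def pos_def neg_def algebra_simps simp flip: b_def)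
    also have "\<dots> = (\<Sum>l\<in>?I. \<nu> (d, l) * (b (l, j) + pos (b (l, k)) * pos ?b - neg (b (l, k)) * neg ?b))
          - max P N * ?b"
      using fin kI by (simp add: sum.distrib)
    also have "\<dots> = V j + P * pos ?b - N * neg ?b - max P N * ?b"
      by (simp add: P_def N_def V_def b_def sum.distrib sum_subtractf sum_distrib_left algebra_simps)
    also have "\<dots> = V j + P * pos ?b - N * neg ?b - max P N * (pos ?b - neg ?b)"
      by (simp add: pos_minus_neg)
    also have "\<dots> = V j - (max P N - P) * pos ?b + (max P N - N) * neg ?b"
      by (simp add: algebra_simps)
    also have "max P N - P = pos (- V k)" by (simp add: V pos_def)
    also have "max P N - N = neg (- V k)" by (simp add: V neg_def)
    finally show ?thesis using False by (simp add: b_def)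
  qed
qed

lemma lifted_exchange_monomial:
  fixes \<nu> :: "'v \<times> 'v \<Rightarrow> int" and t :: "('v, 'k) seed"
  assumes "finite (vertices t)" "D \<inter> vertices t = {}"
    and "\<And>j. j \<in> vertices t \<Longrightarrow> 0 \<le> e j" "\<And>d. d \<in> D \<Longrightarrow> 0 \<le> e d"
  shows "(\<Prod>j\<in>vertices t \<union> D. cluster (lift_seed \<iota> D xD \<nu> t) j ^ nat (e j)) =
    \<iota> (\<Prod>j\<in>vertices t. cluster t j ^ nat (e j)) *
    mon (\<lambda>d. (\<Sum>j\<in>vertices t. \<nu> (d, j) * e j) + e d)"
proof -
  have "(\<Prod>j\<in>vertices t. cluster (lift_seed \<iota> D xD \<nu> t) j ^ nat (e j)) =
      (\<Prod>j\<in>vertices t. \<iota> (cluster t j) ^ nat (e j) * mon (\<lambda>d. \<nu> (d, j) * e j))"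
    using assms(2,3)
    by (intro prod.cong refl, subst cluster_lift) (auto simp: power_mult_distrib laurent_monomial_power)
  also have "\<dots> = \<iota> (\<Prod>j\<in>vertices t. cluster t j ^ nat (e j)) *
      mon (\<lambda>d. \<Sum>j\<in>vertices t. \<nu> (d, j) * e j)"
    by (simp add: prod.distrib mon_prod \<iota>.hom_prod \<iota>.hom_power)
  finally have "(\<Prod>j\<in>vertices t. cluster (lift_seed \<iota> D xD \<nu> t) j ^ nat (e j)) = \<dots>" .
  moreover have "(\<Prod>d\<in>D. cluster (lift_seed \<iota> D xD \<nu> t) d ^ nat (e d)) = mon e"
    unfolding laurent_monomial_def using assms(4)
    by (intro prod.cong) (auto simp: cluster_lift_D power_int_def)
  moreover have "(\<Prod>j\<in>vertices t \<union> D. f j) = (\<Prod>j\<in>vertices t. f j) * (\<Prod>d\<in>D. f d)" for f :: "'v \<Rightarrow> 'l"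
    using assms(1,2) finite_D by (intro prod.union_disjoint) auto
  ultimately show ?thesis
    by (simp add: mult.assoc mon_mult)
qed

text \<open>
The entries $-\nu B$ are chosen so that in the exchange relation of the lifted seed both monomials
carry the same factor in the new variables: the factors $P = \nu B^+_{\bullet,k}$ and
$N = \nu B^-_{\bullet,k}$ coming from the cluster are completed by $\max(N - P, 0)$ and
$\max(P - N, 0)$ to the common exponent $\max(P, N)$, which then leaves the sum.
\<close>

theorem mutate_lift_seed:
  fixes \<nu> :: "'v \<times> 'v \<Rightarrow> int" and t :: "('v, 'k) seed"
  assumes t: "exchange_seed t" and disj: "D \<inter> vertices t = {}" and k: "k \<in> uf t"
  shows "mutate k (lift_seed \<iota> D xD \<nu> t) = lift_seed \<iota> D xD (mutate_lifting D k t \<nu>) (mutate k t)"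
    (is "?l = ?r")
proof (rule seed.equality)
  let ?t = "lift_seed \<iota> D xD \<nu> t" and ?I = "vertices t" and ?\<nu> = "mutate_lifting D k t \<nu>"
  have fin: "finite ?I" and kI: "k \<in> ?I" and kD: "k \<notin> D"
    using t k uf_subset_vertices[of t] disj by (auto simp: exchange_seed_def)
  show "exmat ?l = exmat ?r"
  proof
    fix ij :: "'v \<times> 'v"
    obtain i j where ij: "ij = (i, j)" by (cases ij)
    consider "i \<in> D" "j \<in> uf t" | "i \<in> ?I" "i \<notin> D" "j \<in> uf t" | "\<not> (i \<in> ?I \<union> D \<and> j \<in> uf t)"
      by blast
    then show "exmat ?l ij = exmat ?r ij"
    proof cases
      case 1
      then have "i \<noteq> k" using kD by auto
      with 1 k kI kD show ?thesis
        using lifted_rows_mutate[OF t k 1(2,1), of \<nu>] uf_subset_vertices[of t]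
        by (auto simp: ij exmat_mutate exmat_lift)
    next
      case 2
      with k kI kD show ?thesis by (simp add: ij exmat_mutate exmat_lift)
    next
      case 3
      have "exmat ?l ij = undefined" "exmat ?r ij = undefined"
        using 3 by (auto simp: ij mutate_def[of k ?t] lift_seed_def[of \<iota> D xD _ "mutate k t"] Let_def)
      then show ?thesis by simp
    qed
  qed
  show "cluster ?l = cluster ?r"
  proof
    fix i
    consider "i \<in> D" | "i = k" | "i \<in> ?I" "i \<notin> D" "i \<noteq> k" | "i \<notin> ?I \<union> D" by blast
    then show "cluster ?l i = cluster ?r i"
    proof cases
      case 1
      then have "i \<noteq> k" using kD by auto
      with 1 show ?thesis by (simp add: cluster_mutate cluster_lift_D)
    next
      case 2
      define P where "P = (\<lambda>d. \<Sum>j\<in>?I. \<nu> (d, j) * pos (exmat t (j, k)))"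
      define N where "N = (\<lambda>d. \<Sum>j\<in>?I. \<nu> (d, j) * neg (exmat t (j, k)))"
      let ?b = "\<lambda>j. exmat ?t (j, k)"
      let ?p = "\<Prod>j\<in>?I. cluster t j ^ nat (pos (exmat t (j, k)))"
      let ?n = "\<Prod>j\<in>?I. cluster t j ^ nat (neg (exmat t (j, k)))"
      have bI: "?b j = exmat t (j, k)" if "j \<in> ?I" for j
        using that disj k by (auto simp: exmat_lift)
      have bD: "?b d = N d - P d" if "d \<in> D" for d
      proof -
        have "P d - N d = (\<Sum>j\<in>?I. \<nu> (d, j) * exmat t (j, k))"
          unfolding P_def N_def sum_subtractf[symmetric] right_diff_distrib[symmetric]
          by (simp add: pos_minus_neg)
        then show ?thesis using that k by (simp add: exmat_lift)
      qed
      have "(\<Prod>j\<in>?I \<union> D. cluster ?t j ^ nat (pos (?b j))) =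
          \<iota> (\<Prod>j\<in>?I. cluster t j ^ nat (pos (?b j))) *
          mon (\<lambda>d. (\<Sum>j\<in>?I. \<nu> (d, j) * pos (?b j)) + pos (?b d))"
        by (rule lifted_exchange_monomial[OF fin disj]) auto
      also have "\<dots> = \<iota> ?p * mon (\<lambda>d. P d + pos (?b d))"
        by (simp add: bI P_def)
      also have "mon (\<lambda>d. P d + pos (?b d)) = mon (\<lambda>d. max (P d) (N d))"
        unfolding laurent_monomial_def by (intro prod.cong) (auto simp: bD pos_def max_def)
      finally have p: "(\<Prod>j\<in>?I \<union> D. cluster ?t j ^ nat (pos (?b j))) =
          \<iota> ?p * mon (\<lambda>d. max (P d) (N d))" .
      have "(\<Prod>j\<in>?I \<union> D. cluster ?t j ^ nat (neg (?b j))) =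
          \<iota> (\<Prod>j\<in>?I. cluster t j ^ nat (neg (?b j))) *
          mon (\<lambda>d. (\<Sum>j\<in>?I. \<nu> (d, j) * neg (?b j)) + neg (?b d))"
        by (rule lifted_exchange_monomial[OF fin disj]) auto
      also have "\<dots> = \<iota> ?n * mon (\<lambda>d. N d + neg (?b d))"
        by (simp add: bI N_def)
      also have "mon (\<lambda>d. N d + neg (?b d)) = mon (\<lambda>d. max (P d) (N d))"
        unfolding laurent_monomial_def by (intro prod.cong) (auto simp: bD neg_def max_def)
      finally have n: "(\<Prod>j\<in>?I \<union> D. cluster ?t j ^ nat (neg (?b j))) =
          \<iota> ?n * mon (\<lambda>d. max (P d) (N d))" .
      have "cluster ?l k = inverse (\<iota> (cluster t k) * mon (\<lambda>d. \<nu> (d, k))) *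
          (\<iota> ?p * mon (\<lambda>d. max (P d) (N d)) + \<iota> ?n * mon (\<lambda>d. max (P d) (N d)))"
        using kI kD by (simp add: cluster_mutate p n cluster_lift)
      also have "\<dots> = \<iota> (inverse (cluster t k) * (?p + ?n)) *
          (mon (\<lambda>d. - \<nu> (d, k)) * mon (\<lambda>d. max (P d) (N d)))"
        by (simp only: \<iota>.hom_mult \<iota>.hom_add \<iota>.hom_inverse inverse_mult_distrib
            inverse_laurent_monomial distrib_left distrib_right ac_simps)
      also have "mon (\<lambda>d. - \<nu> (d, k)) * mon (\<lambda>d. max (P d) (N d)) = mon (\<lambda>d. ?\<nu> (d, k))"
        unfolding mon_mult unfolding laurent_monomial_def using kI
        by (intro prod.cong) (auto simp: mutate_lifting_apply P_def N_def)
      also have "\<iota> (inverse (cluster t k) * (?p + ?n)) * \<dots> = cluster ?r k"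
        using kI kD by (simp add: cluster_lift cluster_mutate)
      finally show ?thesis using 2 by simp
    next
      case 3
      then have "mon (\<lambda>d. ?\<nu> (d, i)) = mon (\<lambda>d. \<nu> (d, i))"
        unfolding laurent_monomial_def by (intro prod.cong) (auto simp: mutate_lifting_apply)
      with 3 show ?thesis by (simp add: cluster_mutate cluster_lift)
    next
      case 4
      then show ?thesis
        by (simp add: mutate_def[of k ?t] lift_seed_def[of \<iota> D xD _ "mutate k t"] Let_def)
    qed
  qed
qed simp_all

corollary mutate_seq_lift_seed:
  fixes t :: "('v, 'k) seed"
  assumes "exchange_seed t" "D \<inter> vertices t = {}" "ks \<in> lists (uf t)"
  shows "mutate_seq ks (lift_seed \<iota> D xD \<nu> t) =
    lift_seed \<iota> D xD (mutate_lifting_seq D ks t \<nu>) (mutate_seq ks t)"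
  using assms
  by (induction ks arbitrary: t \<nu>) (auto simp: mutate_lift_seed exchange_seed_mutate)

end

section \<open>Polynomials with coefficients in a subring\<close>

definition poly_over :: "'a::field set \<Rightarrow> 'v set \<Rightarrow> (('v \<Rightarrow>\<^sub>0 nat) \<Rightarrow>\<^sub>0 'a) set" where
  "poly_over R J = {p. mpoly_vars p \<subseteq> J \<and> (\<forall>m. Poly_Mapping.lookup p m \<in> R)}"

lemma poly_over_single:
  "is_subring R \<Longrightarrow> a \<in> R \<Longrightarrow> Poly_Mapping.keys m \<subseteq> J \<Longrightarrow> Poly_Mapping.single m a \<in> poly_over R J"
  by (auto simp: poly_over_def mpoly_vars_def lookup_single when_def is_subring_def split: if_splits)

lemma poly_over_add:
  assumes "is_subring R" "p \<in> poly_over R J" "q \<in> poly_over R J"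
  shows "p + q \<in> poly_over R J"
  using assms mpoly_vars_add[of p q] by (auto simp: poly_over_def lookup_add is_subring_def)

lemma poly_over_uminus:
  "is_subring R \<Longrightarrow> p \<in> poly_over R J \<Longrightarrow> - p \<in> poly_over R J"
  by (simp add: poly_over_def mpoly_vars_uminus is_subring_def)

lemma lookup_mult_sum:
  fixes p q :: "('v \<Rightarrow>\<^sub>0 nat) \<Rightarrow>\<^sub>0 'a::field"
  shows "Poly_Mapping.lookup (p * q) k =
    (\<Sum>m\<in>Poly_Mapping.keys p. \<Sum>n\<in>Poly_Mapping.keys q.
      if m + n = k then Poly_Mapping.lookup p m * Poly_Mapping.lookup q n else 0)"
proof -
  let ?s = "\<lambda>p m. Poly_Mapping.single m (Poly_Mapping.lookup p m)"
  have "p * q = (\<Sum>m\<in>Poly_Mapping.keys p. ?s p m) * (\<Sum>n\<in>Poly_Mapping.keys q. ?s q n)"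
    by (simp flip: poly_mapping_eq_sum_single)
  also have "\<dots> = (\<Sum>m\<in>Poly_Mapping.keys p. \<Sum>n\<in>Poly_Mapping.keys q. ?s p m * ?s q n)"
    by (rule sum_product)
  finally show ?thesis
    by (simp add: mult_single lookup_sum lookup_single when_def)
qed

lemma poly_over_mult:
  assumes "is_subring R" "p \<in> poly_over R J" "q \<in> poly_over R J"
  shows "p * q \<in> poly_over R J"
proof -
  have "Poly_Mapping.lookup (p * q) k \<in> R" for k
    unfolding lookup_mult_sum using assms
    by (intro subring_sum) (auto simp: poly_over_def is_subring_def)
  then show ?thesis
    using assms mpoly_vars_mult[of p q] by (auto simp: poly_over_def)
qed

lemma lookup_mult_monomial:
  fixes p :: "('v \<Rightarrow>\<^sub>0 nat) \<Rightarrow>\<^sub>0 'a::field"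
  shows "Poly_Mapping.lookup (p * Poly_Mapping.single m 1) (k + m) = Poly_Mapping.lookup p k"
proof -
  have "Poly_Mapping.lookup (p * Poly_Mapping.single m 1) (k + m) =
      (\<Sum>n\<in>Poly_Mapping.keys p. if n = k then Poly_Mapping.lookup p n else 0)"
    unfolding lookup_mult_sum by (intro sum.cong) auto
  then show ?thesis by (simp add: in_keys_iff)
qed

section \<open>Laurent polynomials in algebraically independent elements\<close>

context monomial_lifting
begin

text \<open>
The exponent vector of $\prod_{d \in D} x_d^N$. Laurent polynomials in the $x_d$ are represented
below as polynomials over such a common denominator, which reduces their uniqueness
to the algebraic independence of the $x_d$.
\<close>

definition den :: "nat \<Rightarrow> 'v \<Rightarrow>\<^sub>0 nat" where
  "den N = (\<Sum>d\<in>D. Poly_Mapping.single d N)"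

lemma keys_den: "Poly_Mapping.keys (den N) \<subseteq> D"
  unfolding den_def by (rule keys_sum_single) (rule finite_D)

lemma den_add: "den (M + N) = den M + den N"
  by (simp add: den_def single_add sum.distrib)

lemma monom_eval_den_nonzero: "monom_eval xD (den N) \<noteq> 0"
  using xD_nonzero finite_D by (auto simp: den_def monom_eval_sum_single)

lemmas eval_simps = mpoly_eval_add[OF hom] mpoly_eval_mult[OF hom] mpoly_eval_uminus[OF hom]
  mpoly_eval_single[OF hom]

lemma mem_adjoin_units_iff:
  assumes R: "is_subring R"
  shows "y \<in> adjoin_units (\<iota> ` R) (xD ` D) \<longleftrightarrow>
    (\<exists>N. \<exists>p\<in>poly_over R D. y * monom_eval xD (den N) = mpoly_eval \<iota> xD p)"
proof -
  let ?L = "{y. \<exists>N. \<exists>p\<in>poly_over R D. y * monom_eval xD (den N) = mpoly_eval \<iota> xD p}"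
  let ?A = "adjoin_units (\<iota> ` R) (xD ` D)"
  have 01: "0 \<in> R" "1 \<in> R" using R by (auto simp: is_subring_def)
  have mono: "Poly_Mapping.single (den N) 1 \<in> poly_over R D" for N
    using 01 by (intro poly_over_single R keys_den)
  have const: "\<iota> a \<in> ?L" if "a \<in> R" for a
  proof -
    have "Poly_Mapping.single 0 a \<in> poly_over R D"
      using that by (intro poly_over_single R) auto
    then show ?thesis
      by (auto simp: eval_simps den_def intro!: exI[of _ 0] bexI[of _ "Poly_Mapping.single 0 a"])
  qed
  have "is_subring ?L"
    unfolding is_subring_def
  proof (intro conjI ballI)
    show "0 \<in> ?L" "1 \<in> ?L" using const[OF 01(1)] const[OF 01(2)] by simp_all
  next
    fix y z assume "y \<in> ?L" "z \<in> ?L"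
    then obtain N p M q where y: "p \<in> poly_over R D" "y * monom_eval xD (den N) = mpoly_eval \<iota> xD p"
      and z: "q \<in> poly_over R D" "z * monom_eval xD (den M) = mpoly_eval \<iota> xD q" by auto
    have "(y + z) * monom_eval xD (den (N + M)) = mpoly_eval \<iota> xD
        (p * Poly_Mapping.single (den M) 1 + q * Poly_Mapping.single (den N) 1)"
      by (simp add: eval_simps den_add monom_eval_add algebra_simps flip: y(2) z(2))
    then show "y + z \<in> ?L"
      using poly_over_add[OF R poly_over_mult[OF R y(1) mono] poly_over_mult[OF R z(1) mono]] by blast
    have "(y * z) * monom_eval xD (den (N + M)) = mpoly_eval \<iota> xD (p * q)"
      by (simp add: eval_simps den_add monom_eval_add ac_simps flip: y(2) z(2))
    then show "y * z \<in> ?L"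
      using poly_over_mult[OF R y(1) z(1)] by blast
  next
    fix y assume "y \<in> ?L"
    then obtain N p where y: "p \<in> poly_over R D" "y * monom_eval xD (den N) = mpoly_eval \<iota> xD p"
      by auto
    have "(- y) * monom_eval xD (den N) = mpoly_eval \<iota> xD (- p)"
      by (simp add: eval_simps flip: y(2))
    then show "- y \<in> ?L" using poly_over_uminus[OF R y(1)] by blast
  qed
  moreover have "xD d \<in> ?L" if d: "d \<in> D" for d
  proof -
    let ?p = "Poly_Mapping.single (Poly_Mapping.single d 1) 1"
    have "?p \<in> poly_over R D" using d 01 by (intro poly_over_single R) auto
    moreover have "xD d * monom_eval xD (den 0) = mpoly_eval \<iota> xD ?p"
      by (simp add: eval_simps den_def)
    ultimately show ?thesis by blast
  qed
  moreover have "inverse (xD d) \<in> ?L" if d: "d \<in> D" for d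
  proof -
    let ?p = "Poly_Mapping.single (\<Sum>e\<in>D - {d}. Poly_Mapping.single e 1) 1"
    have "?p \<in> poly_over R D"
      using 01 keys_sum_single[of "D - {d}" "\<lambda>_. 1"] finite_D
      by (intro poly_over_single R) blast+
    moreover have "inverse (xD d) * monom_eval xD (den 1) = mpoly_eval \<iota> xD ?p"
      using d finite_D xD_nonzero[OF d]
      by (simp add: eval_simps den_def monom_eval_sum_single prod.remove[of D d])
    ultimately show ?thesis by blast
  qed
  ultimately have "?A \<subseteq> ?L"
    using const by (intro adjoin_units_least) auto
  moreover have "?L \<subseteq> ?A"
  proof
    fix y assume "y \<in> ?L"
    then obtain N p where y: "p \<in> poly_over R D" "y * monom_eval xD (den N) = mpoly_eval \<iota> xD p"
      by auto
    note A = is_subring_adjoin_units[of "\<iota> ` R" "xD ` D"] 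
      and mem = subset_adjoin_units[where R = "\<iota> ` R" and S = "xD ` D"]
    have monA: "monom_eval xD m \<in> ?A" if "Poly_Mapping.keys m \<subseteq> D" for m
      unfolding monom_eval_def using mem(2) that by (intro subring_prod subring_power A) blast
    have "mpoly_eval \<iota> xD p \<in> ?A"
      unfolding mpoly_eval_monom_eval
    proof (intro subring_sum subring_mult A monA)
      fix m assume "m \<in> Poly_Mapping.keys p"
      then show "Poly_Mapping.keys m \<subseteq> D" using y(1) by (auto simp: poly_over_def mpoly_vars_def)
      show "\<iota> (Poly_Mapping.lookup p m) \<in> ?A" using y(1) mem by (auto simp: poly_over_def)
    qed
    moreover have "inverse (monom_eval xD (den N)) = (\<Prod>d\<in>D. inverse (xD d) ^ N)"
      by (simp add: den_def monom_eval_sum_single power_inverse flip: prod_inversef)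
    then have "inverse (monom_eval xD (den N)) \<in> ?A"
      using mem by (auto intro!: subring_prod subring_power A)
    ultimately have "mpoly_eval \<iota> xD p * inverse (monom_eval xD (den N)) \<in> ?A"
      by (rule subring_mult[OF A])
    then show "y \<in> ?A"
      using monom_eval_den_nonzero by (simp add: mult.assoc flip: y(2))
  qed
  ultimately have "?A = ?L" by (rule antisym)
  then show ?thesis by simp
qed

text \<open>
Laurent expansions in independent elements are unique, so an element lies in every $R_s[x_d^{\pm1}]$
exactly when its coefficients, which do not depend on $s$, lie in every $R_s$.
\<close>

lemma INT_adjoin_units:
  fixes R :: "'s \<Rightarrow> 'k set"
  assumes R: "\<And>s. s \<in> S \<Longrightarrow> is_subring (R s)" and "S \<noteq> {}"
  shows "(\<Inter>s\<in>S. adjoin_units (\<iota> ` R s) (xD ` D)) = adjoin_units (\<iota> ` (\<Inter>s\<in>S. R s)) (xD ` D)"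
proof (rule antisym)
  have sub: "is_subring (\<Inter>s\<in>S. R s)" using R unfolding is_subring_def by blast
  show "adjoin_units (\<iota> ` (\<Inter>s\<in>S. R s)) (xD ` D) \<subseteq> (\<Inter>s\<in>S. adjoin_units (\<iota> ` R s) (xD ` D))"
  proof (rule INT_greatest)
    fix s assume "s \<in> S"
    then show "adjoin_units (\<iota> ` (\<Inter>s\<in>S. R s)) (xD ` D) \<subseteq> adjoin_units (\<iota> ` R s) (xD ` D)"
      using subset_adjoin_units[where R = "\<iota> ` R s" and S = "xD ` D"]
      by (intro adjoin_units_least is_subring_adjoin_units) auto
  qed
  show "(\<Inter>s\<in>S. adjoin_units (\<iota> ` R s) (xD ` D)) \<subseteq> adjoin_units (\<iota> ` (\<Inter>s\<in>S. R s)) (xD ` D)"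
  proof
    fix y assume y: "y \<in> (\<Inter>s\<in>S. adjoin_units (\<iota> ` R s) (xD ` D))"
    obtain s0 where "s0 \<in> S" using \<open>S \<noteq> {}\<close> by blast
    then obtain N p where p: "p \<in> poly_over (R s0) D" "y * monom_eval xD (den N) = mpoly_eval \<iota> xD p"
      using y mem_adjoin_units_iff[OF R] by blast
    have "Poly_Mapping.lookup p k \<in> R s" if s: "s \<in> S" for s k
    proof -
      obtain M q where q: "q \<in> poly_over (R s) D" "y * monom_eval xD (den M) = mpoly_eval \<iota> xD q"
        using y s mem_adjoin_units_iff[OF R] by blast
      have "1 \<in> R s" using R[OF s] by (simp add: is_subring_def)
      then have qN: "q * Poly_Mapping.single (den N) 1 \<in> poly_over (R s) D"
        by (intro poly_over_mult poly_over_single R[OF s] q keys_den)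
      \<comment> \<open>Clearing both denominators makes the two expansions of $y$ comparable.\<close>
      have "p * Poly_Mapping.single (den M) 1 \<in> poly_over UNIV D"
        using p(1) keys_den by (intro poly_over_mult poly_over_single) (auto simp: poly_over_def is_subring_def)
      then have "p * Poly_Mapping.single (den M) 1 = q * Poly_Mapping.single (den N) 1"
        using qN
        by (intro mpoly_eval_inject[OF hom indep])
          (auto simp: poly_over_def eval_simps ac_simps simp flip: p(2) q(2))
      then have "Poly_Mapping.lookup p k = Poly_Mapping.lookup (q * Poly_Mapping.single (den N) 1) (k + den M)"
        by (simp add: lookup_mult_monomial[symmetric, of p k "den M"])
      then show ?thesis using qN by (simp add: poly_over_def)
    qed
    then have "p \<in> poly_over (\<Inter>s\<in>S. R s) D" using p(1) by (simp add: poly_over_def)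
    then show "y \<in> adjoin_units (\<iota> ` (\<Inter>s\<in>S. R s)) (xD ` D)"
      using p(2) mem_adjoin_units_iff[OF sub] by blast
  qed
qed

section \<open>Cluster algebras of lifted seeds\<close>

text \<open>
Comparing generators suffices: once a subring contains the units $x_d^{\pm1}$, it should contain the
generators upstairs exactly when it contains the images of those downstairs. This formulation treats
coefficients, cluster variables and their inverses alike.
\<close>

lemma hull_lift:
  assumes "\<And>T. is_subring T \<Longrightarrow> xD ` D \<subseteq> T \<Longrightarrow> inverse ` xD ` D \<subseteq> T \<Longrightarrow> G' \<subseteq> T \<longleftrightarrow> \<iota> ` G \<subseteq> T"
    and "xD ` D \<subseteq> is_subring hull G'" "inverse ` xD ` D \<subseteq> is_subring hull G'"
  shows "is_subring hull G' = adjoin_units (\<iota> ` (is_subring hull G)) (xD ` D)"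
proof (rule antisym)
  let ?A = "adjoin_units (\<iota> ` (is_subring hull G)) (xD ` D)"
  have "\<iota> ` G \<subseteq> ?A"
    using subset_adjoin_units(1)[of "\<iota> ` (is_subring hull G)"] hull_subset[of G is_subring] by blast
  then have "G' \<subseteq> ?A"
    using assms(1)[OF is_subring_adjoin_units subset_adjoin_units(2,3)] by simp
  then show "is_subring hull G' \<subseteq> ?A"
    by (intro hull_minimal is_subring_adjoin_units)
  have "\<iota> ` G \<subseteq> is_subring hull G'"
    using assms(1)[OF is_subring_hull assms(2,3)] hull_subset[of G' is_subring] by simp
  then have "is_subring hull G \<subseteq> \<iota> -` (is_subring hull G')"
    by (intro hull_minimal subring_vimage[OF hom] is_subring_hull) auto
  then show "?A \<subseteq> is_subring hull G'"
    using assms(2,3) by (intro adjoin_units_least is_subring_hull) auto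
qed

text \<open>
A lifted cluster variable differs from the image of the original one by a Laurent monomial in
the $x_d$, which is a unit of every subring that contains the $x_d^{\pm1}$.
\<close>

lemma cluster_lift_mem_iff:
  assumes "is_subring T" "xD ` D \<subseteq> T" "inverse ` xD ` D \<subseteq> T"
    and "i \<in> vertices t" "i \<notin> D"
  shows "cluster (lift_seed \<iota> D xD \<nu> t) i \<in> T \<longleftrightarrow> \<iota> (cluster t i) \<in> T"
    and "inverse (cluster (lift_seed \<iota> D xD \<nu> t) i) \<in> T \<longleftrightarrow> \<iota> (inverse (cluster t i)) \<in> T"
proof -
  have "mon n \<in> T" for n by (rule subring_laurent_monomial[OF assms(1-3)])
  then have *: "y * mon n \<in> T \<longleftrightarrow> y \<in> T" for y n
    by (intro subring_mult_unit_iff assms(1)) (simp_all add: inverse_laurent_monomial mon_nonzero)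
  show "cluster (lift_seed \<iota> D xD \<nu> t) i \<in> T \<longleftrightarrow> \<iota> (cluster t i) \<in> T"
    by (simp add: cluster_lift assms(4,5) *)
  show "inverse (cluster (lift_seed \<iota> D xD \<nu> t) i) \<in> T \<longleftrightarrow> \<iota> (inverse (cluster t i)) \<in> T"
    by (simp add: cluster_lift assms(4,5) * inverse_laurent_monomial \<iota>.hom_inverse)
qed

lemma cluster_lift_image_subset_iff:
  assumes "is_subring T" "xD ` D \<subseteq> T" "inverse ` xD ` D \<subseteq> T"
    and "J \<subseteq> vertices t" "D \<inter> vertices t = {}"
  shows "cluster (lift_seed \<iota> D xD \<nu> t) ` J \<subseteq> T \<longleftrightarrow> \<iota> ` cluster t ` J \<subseteq> T"
    and "inverse ` cluster (lift_seed \<iota> D xD \<nu> t) ` J \<subseteq> T \<longleftrightarrow> \<iota> ` inverse ` cluster t ` J \<subseteq> T"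
proof -
  have i: "i \<in> vertices t" "i \<notin> D" if "i \<in> J" for i
    using that assms(4,5) by auto
  show "cluster (lift_seed \<iota> D xD \<nu> t) ` J \<subseteq> T \<longleftrightarrow> \<iota> ` cluster t ` J \<subseteq> T"
    unfolding image_image image_subset_iff
    by (intro ball_cong refl cluster_lift_mem_iff(1)[OF assms(1-3)] i)
  show "inverse ` cluster (lift_seed \<iota> D xD \<nu> t) ` J \<subseteq> T \<longleftrightarrow> \<iota> ` inverse ` cluster t ` J \<subseteq> T"
    unfolding image_image image_subset_iff
    by (intro ball_cong refl cluster_lift_mem_iff(2)[OF assms(1-3)] i)
qed

lemma cluster_lift_image_D: "cluster (lift_seed \<iota> D xD \<nu> t) ` D = xD ` D"
  by (simp add: cluster_lift_D)

end

lemma equivalent_seeds_eq: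
  "{t'. mutation_equivalent t t'} = (\<lambda>ks. mutate_seq ks t) ` lists (uf t)"
  unfolding mutation_equivalent_def by blast

lemma laurent_ring_eq_hull:
  "laurent_ring c t = is_subring hull (range c \<union> cluster t ` hf t \<union>
     (cluster t ` (sf t \<union> uf t) \<union> inverse ` cluster t ` (sf t \<union> uf t)))"
  by (simp only: laurent_ring_def adjoin_units_def adjoin_def subring_hull_absorb)

lemma cluster_algebra_eq_hull:
  "cluster_algebra c t = is_subring hull (range c \<union> cluster t ` hf t \<union>
     (cluster t ` sf t \<union> inverse ` cluster t ` sf t) \<union>
     (\<Union>ks\<in>lists (uf t). cluster (mutate_seq ks t) ` vertices t))"
  by (simp only: cluster_algebra_def adjoin_units_def adjoin_def subring_hull_absorb
      equivalent_seeds_eq image_image UN_simps mutate_seq_vertices)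

lemma is_subring_laurent_ring: "is_subring (laurent_ring c t)"
  by (simp only: laurent_ring_eq_hull is_subring_hull)

lemma upper_cluster_algebra_eq_INT:
  "upper_cluster_algebra c t = (\<Inter>ks\<in>lists (uf t). laurent_ring c (mutate_seq ks t))"
  by (simp add: upper_cluster_algebra_def equivalent_seeds_eq)

context monomial_lifting
begin

lemma laurent_ring_lift:
  assumes disj: "D \<inter> vertices t = {}"
  shows "laurent_ring (\<iota> \<circ> c) (lift_seed \<iota> D xD \<nu> t) =
    adjoin_units (\<iota> ` laurent_ring c t) (xD ` D)"
  unfolding laurent_ring_eq_hull
proof (rule hull_lift)
  let ?t = "lift_seed \<iota> D xD \<nu> t"
  let ?G = "range (\<iota> \<circ> c) \<union> cluster ?t ` hf ?t \<union>
    (cluster ?t ` (sf ?t \<union> uf ?t) \<union> inverse ` cluster ?t ` (sf ?t \<union> uf ?t))"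
  have "xD ` D \<subseteq> ?G" "inverse ` xD ` D \<subseteq> ?G"
    unfolding lift_seed_simps image_Un cluster_lift_image_D by blast+
  then show "xD ` D \<subseteq> is_subring hull ?G" "inverse ` xD ` D \<subseteq> is_subring hull ?G"
    by (meson hull_subset order_trans)+
  fix T :: "'l set"
  assume T: "is_subring T" "xD ` D \<subseteq> T" "inverse ` xD ` D \<subseteq> T"
  show "?G \<subseteq> T \<longleftrightarrow> \<iota> ` (range c \<union> cluster t ` hf t \<union>
      (cluster t ` (sf t \<union> uf t) \<union> inverse ` cluster t ` (sf t \<union> uf t))) \<subseteq> T"
    unfolding lift_seed_simps image_Un Un_subset_iff cluster_lift_image_D image_comp[symmetric]
      cluster_lift_image_subset_iff[OF T uf_subset_vertices(1) disj]
      cluster_lift_image_subset_iff[OF T uf_subset_vertices(2) disj]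
      cluster_lift_image_subset_iff[OF T uf_subset_vertices(3) disj]
    by (simp only: T(2,3) simp_thms conj_ac)
qed

lemma cluster_algebra_lift:
  assumes t: "exchange_seed t" and disj: "D \<inter> vertices t = {}"
  shows "cluster_algebra (\<iota> \<circ> c) (lift_seed \<iota> D xD \<nu> t) =
    adjoin_units (\<iota> ` cluster_algebra c t) (xD ` D)"
  unfolding cluster_algebra_eq_hull
proof (rule hull_lift)
  let ?t = "lift_seed \<iota> D xD \<nu> t"
  let ?C = "\<Union>ks\<in>lists (uf ?t). cluster (mutate_seq ks ?t) ` vertices ?t"
  let ?G = "range (\<iota> \<circ> c) \<union> cluster ?t ` hf ?t \<union>
    (cluster ?t ` sf ?t \<union> inverse ` cluster ?t ` sf ?t) \<union> ?C"
  have "xD ` D \<subseteq> ?G" "inverse ` xD ` D \<subseteq> ?G"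
    unfolding lift_seed_simps image_Un cluster_lift_image_D by blast+
  then show "xD ` D \<subseteq> is_subring hull ?G" "inverse ` xD ` D \<subseteq> is_subring hull ?G"
    by (meson hull_subset order_trans)+
  fix T :: "'l set"
  assume T: "is_subring T" "xD ` D \<subseteq> T" "inverse ` xD ` D \<subseteq> T"
  have "cluster (mutate_seq ks ?t) ` vertices ?t \<subseteq> T \<longleftrightarrow>
      \<iota> ` cluster (mutate_seq ks t) ` vertices t \<subseteq> T" if "ks \<in> lists (uf t)" for ks
    using that disj T(2)
    by (simp add: mutate_seq_lift_seed[OF t disj] image_Un cluster_lift_image_D
        cluster_lift_image_subset_iff[OF T])
  then have C: "?C \<subseteq> T \<longleftrightarrow> \<iota> ` (\<Union>ks\<in>lists (uf t). cluster (mutate_seq ks t) ` vertices t) \<subseteq> T"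
    by (simp add: UN_subset_iff image_UN)
  then show "?G \<subseteq> T \<longleftrightarrow> \<iota> ` (range c \<union> cluster t ` hf t \<union>
      (cluster t ` sf t \<union> inverse ` cluster t ` sf t) \<union>
      (\<Union>ks\<in>lists (uf t). cluster (mutate_seq ks t) ` vertices t)) \<subseteq> T"
    unfolding lift_seed_simps image_Un Un_subset_iff cluster_lift_image_D image_comp[symmetric]
      C[unfolded lift_seed_simps image_Un]
      cluster_lift_image_subset_iff[OF T uf_subset_vertices(2) disj]
      cluster_lift_image_subset_iff[OF T uf_subset_vertices(3) disj]
    by (simp only: T(2,3) simp_thms conj_ac)
qed

text \<open>
Mutations of the lifted seed are liftings of the mutations of $t$, so that the Laurent rings of the
lifted seed are the rings $\mathcal L(t')[x_d^{\pm1}]$; adjoining the $x_d^{\pm1}$ commutes with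
their intersection.
\<close>

lemma upper_cluster_algebra_lift:
  assumes t: "exchange_seed t" and disj: "D \<inter> vertices t = {}"
  shows "upper_cluster_algebra (\<iota> \<circ> c) (lift_seed \<iota> D xD \<nu> t) =
    adjoin_units (\<iota> ` upper_cluster_algebra c t) (xD ` D)"
proof -
  have "upper_cluster_algebra (\<iota> \<circ> c) (lift_seed \<iota> D xD \<nu> t) =
      (\<Inter>ks\<in>lists (uf t). adjoin_units (\<iota> ` laurent_ring c (mutate_seq ks t)) (xD ` D))"
    unfolding upper_cluster_algebra_eq_INT
    by (intro INF_cong) (simp_all add: mutate_seq_lift_seed[OF t disj] laurent_ring_lift disj)
  also have "\<dots> = adjoin_units (\<iota> ` upper_cluster_algebra c t) (xD ` D)"
    unfolding upper_cluster_algebra_eq_INT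
    by (rule INT_adjoin_units) (auto intro: is_subring_laurent_ring)
  finally show ?thesis .
qed

end

theorem proposition1p0p3:
  fixes c :: "complex \<Rightarrow> 'k::field"
    and t :: "('v, 'k) seed"
    and D :: "'v set"
    and \<iota> :: "'k \<Rightarrow> 'l::field"
    and xD :: "'v \<Rightarrow> 'l"
    and \<nu> :: "'v \<times> 'v \<Rightarrow> int"
  assumes "field_hom c"
    and "is_seed c t"
    and "finite D" and "D \<inter> vertices t = {}"
    and "pointed_extension \<iota> D xD"
    and "\<nu> \<in> lifting_matrices D t"
  shows
    "(\<forall>k\<in>uf t. mutate_lifting D k t \<nu> \<in> lifting_matrices D (mutate k t) \<and>
        mutate k (lift_seed \<iota> D xD \<nu> t) = lift_seed \<iota> D xD (mutate_lifting D k t \<nu>) (mutate k t)) \<and>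
     ((\<forall>t'. mutation_equivalent t t' \<longrightarrow>
         (\<exists>!\<nu>'. \<nu>' \<in> lifting_matrices D t' \<and>
            (\<forall>ks\<in>lists (uf t). t' = mutate_seq ks t \<longrightarrow> \<nu>' = mutate_lifting_seq D ks t \<nu>))) \<and>
      (\<forall>ks\<in>lists (uf t). \<forall>js\<in>lists (uf t). mutate_seq ks t = mutate_seq js t \<longrightarrow>
         mutate_lifting_seq D ks t \<nu> = mutate_lifting_seq D js t \<nu>)) \<and>
     cluster_algebra (\<iota> \<circ> c) (lift_seed \<iota> D xD \<nu> t) =
       adjoin_units (\<iota> ` cluster_algebra c t) (cluster (lift_seed \<iota> D xD \<nu> t) ` D) \<and>
     (maximal_rank t \<longrightarrow>
       upper_cluster_algebra (\<iota> \<circ> c) (lift_seed \<iota> D xD \<nu> t) =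
         adjoin_units (\<iota> ` upper_cluster_algebra c t) (cluster (lift_seed \<iota> D xD \<nu> t) ` D))"
proof -
  interpret monomial_lifting \<iota> D xD
    using assms(3,5) by (auto simp: pointed_extension_def intro!: monomial_lifting.intro)
  have t: "exchange_seed t"
    using assms(2) by (simp add: is_seed_def exchange_seed_def)
  have indep_t: "algebraically_independent c (vertices t) (cluster t)"
    using assms(2) by (simp add: is_seed_def transcendence_basis_def)
  have unique: "mutate_lifting_seq D ks t \<nu> = mutate_lifting_seq D js t \<nu>"
    if "ks \<in> lists (uf t)" "js \<in> lists (uf t)" "mutate_seq ks t = mutate_seq js t" for ks js
    using mutate_lifting_seq_unique[OF assms(1) indep_t assms(6) that] .
  have "\<exists>!\<nu>'. \<nu>' \<in> lifting_matrices D t' \<and>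
      (\<forall>ks\<in>lists (uf t). t' = mutate_seq ks t \<longrightarrow> \<nu>' = mutate_lifting_seq D ks t \<nu>)"
    if equiv: "mutation_equivalent t t'" for t'
  proof -
    obtain js where js: "js \<in> lists (uf t)" "t' = mutate_seq js t"
      using equiv unfolding mutation_equivalent_def by blast
    show ?thesis
    proof (rule ex1I[of _ "mutate_lifting_seq D js t \<nu>"])
      show "mutate_lifting_seq D js t \<nu> \<in> lifting_matrices D t' \<and>
          (\<forall>ks\<in>lists (uf t). t' = mutate_seq ks t \<longrightarrow>
            mutate_lifting_seq D js t \<nu> = mutate_lifting_seq D ks t \<nu>)"
        using mutate_lifting_seq_mem[OF assms(6), of js] unique[OF js(1)] js(2) by simp
    next
      fix \<nu>'
      assume "\<nu>' \<in> lifting_matrices D t' \<and>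
          (\<forall>ks\<in>lists (uf t). t' = mutate_seq ks t \<longrightarrow> \<nu>' = mutate_lifting_seq D ks t \<nu>)"
      with js show "\<nu>' = mutate_lifting_seq D js t \<nu>" by simp
    qed
  qed
  then show ?thesis
    unfolding cluster_lift_image_D
    by (intro conjI ballI allI impI unique mutate_lifting_mem mutate_lift_seed[OF t assms(4)]
        cluster_algebra_lift[OF t assms(4)] upper_cluster_algebra_lift[OF t assms(4)])
qed

end
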